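(* For all integers $k \ge 2$ and $n \ge k+1$, we have $\mathrm{La}^*(n,\{Y_k,Y_k'\}) = \Sigma(n,k)$.
   Context: Let $[n]=\{1,2,\dots,n\}$, let $2^{[n]}$ denote the power set of $[n]$, and let $\binom{[n]}{i}$ denote the set of all $i$-element subsets of $[n]$ (for $0\le i\le n$); the sets $\binom{[n]}{i}$ are called the levels of $2^{[n]}$. $\Sigma(n,k)$ denotes the sum of the sizes of the $k$ largest levels of $2^{[n]}$, i.e. the sum of the $k$ largest binomial coefficients among $\binom{n}{0},\binom{n}{1},\dots,\binom{n}{n}$ (counted with multiplicity). A poset $P$ is an induced subposet of a poset $Q$ if there exists an injection $\phi:P\to Q$ such that $x<y$ in $P$ if and only if $\phi(x)<\phi(y)$ in $Q$. A family $\mathcal{A}\subset 2^{[n]}$ is regarded as a poset under set containment, and $\mathcal{A}$ is called induced $P$-free if $P$ is not an induced subposet of $\mathcal{A}$. For a collection of posets $\mathcal{P}$, define $$\mathrm{La}^*(n,\mathcal{P})=\max\{|\mathcal{A}| : \mathcal{A}\subset 2^{[n]} \text{ and } \mathcal{A} \text{ is induced } P\text{-free for all } P\in\mathcal{P}\}.$$ $Y_k$ denotes the poset on $k+2$ elements $x_1,x_2,\dots,x_k,y,z$ whose relations are generated by $x_1<x_2<\dots<x_k$, $x_k<y$, $x_k<z$ (so $y$ and $z$ are incomparable). $Y_k'$ denotes the same poset with all relations reversed. *)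

theory Defs
  imports Complex_Main
begin

text \<open>A poset is a pair of a carrier set and its strict order relation on that carrier.\<close>

type_synonym 'a poset = "'a set \<times> ('a \<times> 'a) set"

definition is_poset :: "'a poset \<Rightarrow> bool" where
  "is_poset P \<longleftrightarrow> snd P \<subseteq> fst P \<times> fst P \<and> irrefl (snd P) \<and> trans (snd P)"

definition induced_subposet :: "'a poset \<Rightarrow> 'b poset \<Rightarrow> bool" where
  "induced_subposet P Q \<longleftrightarrow>
     (\<exists>\<phi>. inj_on \<phi> (fst P) \<and> \<phi> ` fst P \<subseteq> fst Q \<and>
          (\<forall>x\<in>fst P. \<forall>y\<in>fst P. (x, y) \<in> snd P \<longleftrightarrow> (\<phi> x, \<phi> y) \<in> snd Q))"

definition family_poset :: "'a set set \<Rightarrow> 'a set poset" where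
  "family_poset \<A> = (\<A>, {(S, T). S \<in> \<A> \<and> T \<in> \<A> \<and> S \<subset> T})"

definition induced_free :: "'a poset \<Rightarrow> 'b set set \<Rightarrow> bool" where
  "induced_free P \<A> \<longleftrightarrow> \<not> induced_subposet P (family_poset \<A>)"

definition dual_poset :: "'a poset \<Rightarrow> 'a poset" where
  "dual_poset P = (fst P, (snd P)\<inverse>)"

definition La_star :: "nat \<Rightarrow> 'a poset set \<Rightarrow> nat" where
  "La_star n \<P> = Max {card \<A> | \<A>. \<A> \<subseteq> Pow {1..n} \<and> (\<forall>P\<in>\<P>. induced_free P \<A>)}"

definition level :: "nat \<Rightarrow> nat \<Rightarrow> nat set set" where
  "level n i = {S. S \<subseteq> {1..n} \<and> card S = i}"

text \<open>The list of level sizes keeps repeated values, so they count with multiplicity.\<close>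

definition Sigma_levels :: "nat \<Rightarrow> nat \<Rightarrow> nat" where
  "Sigma_levels n k = sum_list (take k (rev (sort (map (\<lambda>i. card (level n i)) [0..<n + 1]))))"

datatype Y_vertex = Vx nat | Vy | Vz

definition Y_cover :: "nat \<Rightarrow> (Y_vertex \<times> Y_vertex) set" where
  "Y_cover k = {(Vx i, Vx (i + 1)) | i. 1 \<le> i \<and> i < k} \<union> {(Vx k, Vy), (Vx k, Vz)}"

definition Y_poset :: "nat \<Rightarrow> Y_vertex poset" where
  "Y_poset k = (Vx ` {1..k} \<union> {Vy, Vz}, (Y_cover k)\<^sup>+)"

definition Y_dual :: "nat \<Rightarrow> Y_vertex poset" where
  "Y_dual k = dual_poset (Y_poset k)"

lemma card_level: "card (level n i) = n choose i"
  unfolding level_def using n_subsets[of "{1..n}" i] by simp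

lemma card_Y_poset: "card (fst (Y_poset k)) = k + 2"
proof -
  have "card (Vx ` {1..k}) = k" by (simp add: card_image inj_on_def)
  moreover have "Vx ` {1..k} \<inter> {Vy, Vz} = {}" by auto
  ultimately show ?thesis by (simp add: Y_poset_def card_Un_disjoint)
qed

lemma Y_less_iff:
  "(a, b) \<in> (Y_cover k)\<^sup>+ \<longleftrightarrow>
     (\<exists>i j. a = Vx i \<and> b = Vx j \<and> 1 \<le> i \<and> i < j \<and> j \<le> k) \<or>
     (\<exists>i. a = Vx i \<and> (1 \<le> i \<or> i = k) \<and> i \<le> k \<and> (b = Vy \<or> b = Vz))"
  (is "_ \<longleftrightarrow> ?R a b")
proof
  assume "(a, b) \<in> (Y_cover k)\<^sup>+"
  then show "?R a b"
  proof (induction rule: trancl_induct)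
    case (base b)
    then show ?case by (auto simp: Y_cover_def)
  next
    case (step b c)
    then show ?case by (auto simp: Y_cover_def)
  qed
next
  have chain: "(Vx i, Vx j) \<in> (Y_cover k)\<^sup>*" if "1 \<le> i" "i \<le> j" "j \<le> k" for i j
    using that(2,1,3)
  proof (induction j rule: dec_induct)
    case base
    then show ?case by simp
  next
    case (step j)
    then have "(Vx j, Vx (Suc j)) \<in> Y_cover k" by (auto simp: Y_cover_def)
    with step show ?case by (auto intro: rtrancl_into_rtrancl)
  qed
  assume "?R a b"
  then consider
      (path) i j where "a = Vx i" "b = Vx j" "1 \<le> i" "i < j" "j \<le> k"
    | (leaf) i where "a = Vx i" "1 \<le> i \<or> i = k" "i \<le> k" "b = Vy \<or> b = Vz"
    by blast
  then show "(a, b) \<in> (Y_cover k)\<^sup>+"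
  proof cases
    case path
    then have "(Vx i, Vx (i + 1)) \<in> Y_cover k"
      by (auto simp: Y_cover_def)
    moreover have "(Vx (i + 1), Vx j) \<in> (Y_cover k)\<^sup>*"
      using path by (intro chain) auto
    ultimately show ?thesis
      unfolding path(1,2) by (rule rtrancl_into_trancl2)
  next
    case leaf
    have "(Vx i, Vx k) \<in> (Y_cover k)\<^sup>*"
      using leaf chain[of i k] by blast
    moreover have "(Vx k, b) \<in> Y_cover k"
      using leaf(4) by (auto simp: Y_cover_def)
    ultimately show ?thesis
      unfolding leaf(1) by (rule rtrancl_into_trancl1)
  qed
qed

lemma is_poset_Y_poset:
  assumes "1 \<le> k"
  shows "is_poset (Y_poset k)"
proof -
  have "Y_cover k \<subseteq> fst (Y_poset k) \<times> fst (Y_poset k)"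
    using assms by (auto simp: Y_cover_def Y_poset_def)
  then have "(Y_cover k)\<^sup>+ \<subseteq> fst (Y_poset k) \<times> fst (Y_poset k)"
    by (rule trancl_subset_Sigma)
  moreover have "irrefl ((Y_cover k)\<^sup>+)"
    by (rule irreflI) (simp only: Y_less_iff, auto)
  moreover have "snd (Y_poset k) = (Y_cover k)\<^sup>+"
    by (simp add: Y_poset_def)
  ultimately show ?thesis
    by (simp only: is_poset_def trans_trancl simp_thms)
qed

lemma is_poset_Y_dual:
  assumes "1 \<le> k"
  shows "is_poset (Y_dual k)"
proof -
  have *: "snd (Y_poset k) \<subseteq> fst (Y_poset k) \<times> fst (Y_poset k)"
    "irrefl (snd (Y_poset k))" "trans (snd (Y_poset k))"
    using is_poset_Y_poset[OF assms] by (simp_all only: is_poset_def)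
  have "(snd (Y_poset k))\<inverse> \<subseteq> fst (Y_poset k) \<times> fst (Y_poset k)"
    using *(1) by blast
  moreover have "irrefl ((snd (Y_poset k))\<inverse>)"
    using *(2) unfolding irrefl_def by blast
  moreover have "trans ((snd (Y_poset k))\<inverse>)"
    using *(3) unfolding trans_def by blast
  ultimately show ?thesis
    by (simp only: is_poset_def Y_dual_def dual_poset_def fst_conv snd_conv simp_thms)
qed

text \<open>The maximum is taken over a finite set, which is nonempty when no forbidden poset is empty.\<close>

lemma La_star_attained:
  assumes "\<And>P. P \<in> \<P> \<Longrightarrow> fst P \<noteq> {}"
  shows "\<exists>\<A>. \<A> \<subseteq> Pow {1..n} \<and> (\<forall>P\<in>\<P>. induced_free P \<A>) \<and> card \<A> = La_star n \<P>"
proof -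
  let ?F = "{\<A>. \<A> \<subseteq> Pow {1..n} \<and> (\<forall>P\<in>\<P>. induced_free P \<A>)}"
  have eq: "{card \<A> | \<A>. \<A> \<subseteq> Pow {1..n} \<and> (\<forall>P\<in>\<P>. induced_free P \<A>)} = card ` ?F"
    by auto
  have "finite ?F"
    by (rule finite_subset[of _ "Pow (Pow {1..n})"]) auto
  moreover have "{} \<in> ?F"
    using assms by (auto simp: induced_free_def induced_subposet_def family_poset_def)
  ultimately have "Max (card ` ?F) \<in> card ` ?F"
    by (intro Max_in) auto
  then obtain \<A> where "\<A> \<in> ?F" "Max (card ` ?F) = card \<A>"
    by (rule imageE)
  moreover have "La_star n \<P> = Max (card ` ?F)"
    unfolding La_star_def eq ..
  ultimately show ?thesis by (intro exI[of _ \<A>]) simp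
qed

end

theory Submission
  imports Defs "HOL-Combinatorics.Multiset_Permutations"
begin

text \<open>
  The union of the \<open>k\<close> largest levels has no chain of \<open>k + 1\<close> sets, so it contains neither poset;
  this is the lower bound. The upper bound is an argument in the style of Lubell: a random maximal
  chain of $2^{[n]}$ should meet a free family \<open>F\<close> at most \<open>k\<close> times on average, and then a weighted
  LYM argument (\<open>card_le_of_weighted_sum\<close>) bounds \<open>F\<close> by the \<open>k\<close> largest levels.

  Call a member of \<open>F\<close> a top if it ends a chain of \<open>k\<close> members, and a bottom if it starts one.
  Freeness says that the members above a top form a chain, and so do the members below a bottom. A
  maximal chain with more than \<open>k\<close> hits therefore has its outermost hits in two such rigid chains, and it can be
  rerouted there to lose hits: exchanging two neighbouring entries of the ordering that
  generates the maximal chain alters a single level, so an outer hit has conditional probability at most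
  one half (\<open>two_card_hit_le\<close>). If the highest bottom \<open>P\<close> and the lowest top \<open>Q\<close> on the maximal chain satisfy
  \<open>P \<subset> Q\<close>, this alone brings the average down to \<open>k\<close> (\<open>middle_class_sum\<close>). Otherwise
  some hit \<open>A\<close> is both top and bottom. Taking the lowest such \<open>A\<close>, the maximal chain above \<open>A\<close> is
  still uniform, so the average number of hits there is at most a sum of reciprocal binomial coefficients,
  which never exceeds \<open>2 / 3\<close> (\<open>lowest_class_sum\<close>). For \<open>k = 2\<close> the estimate
  \<open>1 / 2 + 1 + 2 / 3\<close> would be too large when a singleton lies below \<open>A\<close>. Therefore singletons get half
  weight if \<open>n \<ge> 5\<close>; this costs nothing in the end, since their level has at most half the size of the
  second largest one.

  These estimates are for families of nonempty proper subsets. If \<open>F\<close> contains the empty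
  set, the rest of \<open>F\<close> obeys the condition above tops already for \<open>k - 1\<close>, and the
  resulting gain outweighs the two extreme sets (\<open>card_le_if_empty_mem\<close>). Complementation
  reduces the case of the full set to this one.
\<close>

section \<open>Chains in a family of sets\<close>

text \<open>A member of \<^term>\<open>tops k F\<close> can play the part of $x_k$ in $Y_k$, and a member of
  \<^term>\<open>bottoms k F\<close> the same part in the reversed poset. Both notions ask for at least \<^term>\<open>k\<close>
  elements, so that no longer chain has to be cut down to size.\<close>

definition tops :: "nat \<Rightarrow> 'a set set \<Rightarrow> 'a set set" where
  "tops k F = {A \<in> F. \<exists>K\<subseteq>F. finite K \<and> chain_subset K \<and> k \<le> card K \<and> A \<in> K \<and> (\<forall>X\<in>K. X \<subseteq> A)}"

definition bottoms :: "nat \<Rightarrow> 'a set set \<Rightarrow> 'a set set" where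
  "bottoms k F = {A \<in> F. \<exists>K\<subseteq>F. finite K \<and> chain_subset K \<and> k \<le> card K \<and> A \<in> K \<and> (\<forall>X\<in>K. A \<subseteq> X)}"

lemma chain_Union_mem: "finite K \<Longrightarrow> K \<noteq> {} \<Longrightarrow> chain_subset K \<Longrightarrow> \<Union>K \<in> K"
  by (metis Union_in_chain chain_subset_alt_def)

lemma chain_Inter_mem: "finite K \<Longrightarrow> K \<noteq> {} \<Longrightarrow> chain_subset K \<Longrightarrow> \<Inter>K \<in> K"
  by (metis Inter_in_chain chain_subset_alt_def)

lemma chain_subset_mono: "chain_subset K \<Longrightarrow> L \<subseteq> K \<Longrightarrow> chain_subset L"
  unfolding chain_subset_def by blast

lemma chain_subset_Un:
  assumes "chain_subset K" "chain_subset L" "\<And>X Y. X \<in> K \<Longrightarrow> Y \<in> L \<Longrightarrow> X \<subseteq> Y"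
  shows "chain_subset (K \<union> L)"
  using assms unfolding chain_subset_def by (metis Un_iff)

text \<open>A chain of at least \<^term>\<open>k\<close> members makes its own largest member a top. Read backwards, this
  bounds the length of any chain that stops below the tops, and dually above the bottoms.\<close>

lemma card_chain_less_if_Union_not_top:
  assumes "finite K" "chain_subset K" "K \<subseteq> F" "K \<noteq> {}" "\<Union>K \<notin> tops k F"
  shows "card K < k"
proof (rule ccontr)
  assume "\<not> card K < k"
  then have "\<Union>K \<in> tops k F"
    using assms chain_Union_mem[of K] unfolding tops_def
    by (auto intro!: exI[of _ K])
  with assms show False by simp
qed

lemma card_chain_less_if_Inter_not_bottom:
  assumes "finite K" "chain_subset K" "K \<subseteq> F" "K \<noteq> {}" "\<Inter>K \<notin> bottoms k F"
  shows "card K < k"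
proof (rule ccontr)
  assume "\<not> card K < k"
  then have "\<Inter>K \<in> bottoms k F"
    using assms chain_Inter_mem[of K] unfolding bottoms_def
    by (auto intro!: exI[of _ K])
  with assms show False by simp
qed

lemma bottoms_downward:
  assumes "A \<in> bottoms k F" "B \<in> F" "B \<subseteq> A"
  shows "B \<in> bottoms k F"
proof -
  obtain K where K: "K \<subseteq> F" "finite K" "chain_subset K" "k \<le> card K" "\<forall>X\<in>K. A \<subseteq> X"
    using assms(1) unfolding bottoms_def by blast
  have "k \<le> card (insert B K)"
    using K(2,4) by (simp add: card_insert_if)
  moreover have "chain_subset (insert B K)"
    using K(3,5) assms(3) unfolding chain_subset_def by blast
  ultimately show ?thesis
    using K assms(2,3) unfolding bottoms_def
    by (intro CollectI conjI exI[of _ "insert B K"]) auto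
qed

lemma chain_enumeration:
  assumes "finite K" "chain_subset K" "1 \<le> k" "k \<le> card K" "A \<in> K" "\<forall>X\<in>K. X \<subseteq> A"
  shows "\<exists>f. f k = A \<and> (\<forall>i\<in>{1..k}. f i \<in> K) \<and> (\<forall>i j. 1 \<le> i \<and> i < j \<and> j \<le> k \<longrightarrow> f i \<subset> f j)"
  using assms(3,1,2,4-)
proof (induction k arbitrary: K A rule: dec_induct)
  case base
  then show ?case by (intro exI[of _ "\<lambda>_. A"]) auto
next
  case (step k)
  let ?L = "K - {A}"
  have card: "k \<le> card ?L"
    using step by simp
  then have ne: "?L \<noteq> {}" using step.hyps by (metis card.empty not_one_le_zero le_trans)
  have ch: "chain_subset ?L" "finite ?L"
    using step.prems chain_subset_mono[of K ?L] by auto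
  have mem: "\<Union>?L \<in> ?L" by (rule chain_Union_mem[OF ch(2) ne ch(1)])
  obtain f where f: "f k = \<Union>?L" "\<forall>i\<in>{1..k}. f i \<in> ?L"
      "\<forall>i j. 1 \<le> i \<and> i < j \<and> j \<le> k \<longrightarrow> f i \<subset> f j"
    using step.IH[OF ch(2,1) card mem] by blast
  have below: "f i \<subset> A" if "1 \<le> i" "i \<le> k" for i
    using f(2) that step.prems(5) by (metis DiffE atLeastAtMost_iff insertI1 psubsetI)
  show ?case
  proof (intro exI[of _ "f(Suc k := A)"] conjI ballI allI impI)
    fix i assume "i \<in> {1..Suc k}"
    then show "(f(Suc k := A)) i \<in> K"
      using f(2) step.prems(4) by (cases "i = Suc k") auto
  next
    fix i j assume "1 \<le> i \<and> i < j \<and> j \<le> Suc k"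
    then show "(f(Suc k := A)) i \<subset> (f(Suc k := A)) j"
      using f(3) below by (cases "j = Suc k") auto
  qed simp
qed

section \<open>What the two forbidden posets say about chains\<close>

text \<open>Two incomparable members above a top would be the two prongs of $Y_k$, whose handle is the
  chain that ends in this top.\<close>

lemma chain_above_top:
  assumes "1 \<le> k" "induced_free (Y_poset k) F" "A \<in> tops k F"
  shows "chain_subset {B \<in> F. A \<subset> B}"
proof (rule ccontr)
  assume "\<not> chain_subset {B \<in> F. A \<subset> B}"
  then obtain B C where BC: "B \<in> F" "C \<in> F" "A \<subset> B" "A \<subset> C" "\<not> B \<subseteq> C" "\<not> C \<subseteq> B"
    unfolding chain_subset_def by blast
  obtain K where "K \<subseteq> F" "finite K" "chain_subset K" "k \<le> card K" "A \<in> K" "\<forall>X\<in>K. X \<subseteq> A"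
    using assms(3) unfolding tops_def by blast
  then obtain f where f: "f k = A" "\<forall>i\<in>{1..k}. f i \<in> F"
      "\<forall>i j. 1 \<le> i \<and> i < j \<and> j \<le> k \<longrightarrow> f i \<subset> f j"
    using chain_enumeration[of K k A] assms(1) by blast
  have below: "f i \<subseteq> A" if "1 \<le> i" "i \<le> k" for i
    using f(1,3) that by (metis le_neq_implies_less order_refl psubset_imp_subset)
  have mono_iff: "f i \<subset> f j \<longleftrightarrow> i < j" if "1 \<le> i" "i \<le> k" "1 \<le> j" "j \<le> k" for i j
    using f(3) that by (metis linorder_neqE_nat order_less_asym order_less_irrefl)
  have lt: "f i \<subset> B" "f i \<subset> C" if "1 \<le> i" "i \<le> k" for i
    using below[OF that] BC(3,4) by blast+
  have nlt: "\<not> B \<subset> f i" "\<not> C \<subset> f i" if "1 \<le> i" "i \<le> k" for i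
    using lt[OF that] by blast+
  have BC': "\<not> B \<subset> C" "\<not> C \<subset> B" "B \<noteq> C" "C \<noteq> B"
    using BC(5,6) by blast+
  have ne: "f i \<noteq> B" "f i \<noteq> C" "B \<noteq> f i" "C \<noteq> f i" if "1 \<le> i" "i \<le> k" for i
    using lt[OF that] by blast+
  define \<phi> where "\<phi> v = (case v of Vx i \<Rightarrow> f i | Vy \<Rightarrow> B | Vz \<Rightarrow> C)" for v
  have \<phi>: "\<phi> (Vx i) = f i" "\<phi> Vy = B" "\<phi> Vz = C" for i
    by (simp_all add: \<phi>_def)
  let ?V = "Vx ` {1..k} \<union> {Vy, Vz}"
  have mem: "\<phi> v \<in> F" if "v \<in> ?V" for v
    using that f(2) BC(1,2) by (auto simp: \<phi>)
  have inj: "f i = f j \<longleftrightarrow> i = j" if "1 \<le> i" "i \<le> k" "1 \<le> j" "j \<le> k" for i j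
    using mono_iff[OF that] mono_iff[of j i] that by (cases i j rule: linorder_cases) auto
  have "inj_on \<phi> ?V"
  proof (rule inj_onI)
    fix u v assume "u \<in> ?V" "v \<in> ?V" "\<phi> u = \<phi> v"
    then show "u = v"
      by (cases u; cases v) (auto simp: \<phi> inj ne BC')
  qed
  moreover have "(u, v) \<in> (Y_cover k)\<^sup>+ \<longleftrightarrow> (\<phi> u, \<phi> v) \<in> snd (family_poset F)"
    if uv: "u \<in> ?V" "v \<in> ?V" for u v
  proof -
    have "(u, v) \<in> (Y_cover k)\<^sup>+ \<longleftrightarrow> \<phi> u \<subset> \<phi> v"
    proof -
      have "(\<exists>i. w = Vx i \<and> 1 \<le> i \<and> i \<le> k) \<or> w = Vy \<or> w = Vz" if "w \<in> ?V" for w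
        using that by auto
      from this[OF uv(1)] this[OF uv(2)] show ?thesis
        unfolding Y_less_iff
        by (elim disjE exE conjE) (simp_all add: \<phi> mono_iff lt nlt BC'(1,2))
    qed
    then show ?thesis using mem uv by (simp add: family_poset_def)
  qed
  ultimately have "induced_subposet (Y_poset k) (family_poset F)"
    unfolding induced_subposet_def
    by (intro exI[of _ \<phi>]) (use mem in \<open>auto simp: Y_poset_def family_poset_def\<close>)
  with assms(2) show False by (simp add: induced_free_def)
qed

lemma chain_image_antimono:
  assumes "chain_subset K" "\<And>X Y. X \<in> K \<Longrightarrow> Y \<in> K \<Longrightarrow> X \<subseteq> Y \<Longrightarrow> c Y \<subseteq> c X"
  shows "chain_subset (c ` K)"
  using assms unfolding chain_subset_def by (metis imageE)

text \<open>Complementation reverses inclusion, so it exchanges the two forbidden posets, and tops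
  with bottoms.\<close>

lemma induced_free_complement:
  assumes "induced_free (Y_dual k) F" "F \<subseteq> Pow V"
  shows "induced_free (Y_poset k) ((-) V ` F)"
  unfolding induced_free_def
proof
  let ?F = "(-) V ` F"
  assume "induced_subposet (Y_poset k) (family_poset ?F)"
  then obtain \<phi> where \<phi>: "inj_on \<phi> (fst (Y_poset k))" "\<phi> ` fst (Y_poset k) \<subseteq> ?F"
    "\<forall>x\<in>fst (Y_poset k). \<forall>y\<in>fst (Y_poset k).
      (x, y) \<in> snd (Y_poset k) \<longleftrightarrow> (\<phi> x, \<phi> y) \<in> snd (family_poset ?F)"
    unfolding induced_subposet_def by (auto simp: family_poset_def)
  have mem: "V - \<phi> x \<in> F" "\<phi> x \<subseteq> V" "\<phi> x \<in> ?F" if "x \<in> fst (Y_poset k)" for x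
  proof -
    show "\<phi> x \<in> ?F" using \<phi>(2) that by blast
    then obtain X where "X \<in> F" "\<phi> x = V - X" by blast
    then show "V - \<phi> x \<in> F" "\<phi> x \<subseteq> V" using assms(2) by (auto simp: double_diff)
  qed
  have "induced_subposet (Y_dual k) (family_poset F)"
    unfolding induced_subposet_def
  proof (intro exI[of _ "\<lambda>x. V - \<phi> x"] conjI ballI)
    show "inj_on (\<lambda>x. V - \<phi> x) (fst (Y_dual k))"
    proof (rule inj_onI)
      fix x y assume "x \<in> fst (Y_dual k)" "y \<in> fst (Y_dual k)" "V - \<phi> x = V - \<phi> y"
      then show "x = y"
        using mem(2)[of x] mem(2)[of y] inj_onD[OF \<phi>(1), of x y]
        by (simp add: Y_dual_def dual_poset_def) (metis double_diff order_refl)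
    qed
    show "(\<lambda>x. V - \<phi> x) ` fst (Y_dual k) \<subseteq> fst (family_poset F)"
      using mem by (auto simp: Y_dual_def dual_poset_def family_poset_def)
    fix x y assume xy: "x \<in> fst (Y_dual k)" "y \<in> fst (Y_dual k)"
    then have xy': "x \<in> fst (Y_poset k)" "y \<in> fst (Y_poset k)"
      by (simp_all add: Y_dual_def dual_poset_def)
    have "(x, y) \<in> snd (Y_dual k) \<longleftrightarrow> (\<phi> y, \<phi> x) \<in> snd (family_poset ?F)"
      using \<phi>(3) xy' by (simp add: Y_dual_def dual_poset_def)
    also have "\<dots> \<longleftrightarrow> \<phi> y \<subset> \<phi> x"
      using mem(3) xy' by (simp add: family_poset_def)
    also have "\<dots> \<longleftrightarrow> V - \<phi> x \<subset> V - \<phi> y"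
      using mem(2)[OF xy'(1)] mem(2)[OF xy'(2)] by blast
    also have "\<dots> \<longleftrightarrow> (V - \<phi> x, V - \<phi> y) \<in> snd (family_poset F)"
      using mem xy' by (simp add: family_poset_def)
    finally show "(x, y) \<in> snd (Y_dual k) \<longleftrightarrow> (V - \<phi> x, V - \<phi> y) \<in> snd (family_poset F)" .
  qed
  with assms show False by (simp add: induced_free_def)
qed

lemma top_complement:
  assumes "A \<in> bottoms k F" "F \<subseteq> Pow V"
  shows "V - A \<in> tops k ((-) V ` F)"
proof -
  obtain K where K: "A \<in> F" "K \<subseteq> F" "finite K" "chain_subset K" "k \<le> card K" "A \<in> K"
      "\<forall>X\<in>K. A \<subseteq> X"
    using assms unfolding bottoms_def by blast
  have "inj_on ((-) V) K"
    using K(2) assms(2) by (intro inj_on_inverseI[of _ "(-) V"]) (auto simp: double_diff)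
  then have "card ((-) V ` K) = card K" by (rule card_image)
  moreover have "chain_subset ((-) V ` K)"
    by (rule chain_image_antimono[OF K(4)]) auto
  ultimately show ?thesis
    using K unfolding tops_def by (intro CollectI conjI exI[of _ "(-) V ` K"]) auto
qed

lemma chain_below_bottom:
  assumes "1 \<le> k" "induced_free (Y_dual k) F" "A \<in> bottoms k F"
  shows "chain_subset {B \<in> F. B \<subset> A}"
proof -
  let ?S = "{B \<in> (-) UNIV ` F. UNIV - A \<subset> B}"
  have "chain_subset ?S"
    by (intro chain_above_top[OF assms(1)] induced_free_complement top_complement assms(2,3)) auto
  then have "chain_subset ((-) UNIV ` ?S)"
    by (rule chain_image_antimono) auto
  moreover have "{B \<in> F. B \<subset> A} \<subseteq> (-) UNIV ` ?S"
  proof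
    fix B assume "B \<in> {B \<in> F. B \<subset> A}"
    then have "UNIV - B \<in> ?S" by auto
    then have "UNIV - (UNIV - B) \<in> (-) UNIV ` ?S" by (rule imageI)
    then show "B \<in> (-) UNIV ` ?S" by (simp add: double_diff)
  qed
  ultimately show ?thesis by (rule chain_subset_mono)
qed

section \<open>Random maximal chains\<close>

text \<open>An ordering \<^term>\<open>xs\<close> of the ground set stands for the maximal chain formed by its prefixes.
  Hence \<^term>\<open>hits F xs\<close> is what this maximal chain meets of \<^term>\<open>F\<close>, and averages over a
  uniformly random maximal chain become sums over all orderings.\<close>

definition hits :: "'a set set \<Rightarrow> 'a list \<Rightarrow> 'a set set" where
  "hits F xs = {A \<in> F. set (take (card A) xs) = A}"

lemma hitsD: "A \<in> hits F xs \<Longrightarrow> A \<in> F" "A \<in> hits F xs \<Longrightarrow> set (take (card A) xs) = A"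
  by (simp_all add: hits_def)

lemma hits_nested:
  assumes "A \<in> hits F xs" "B \<in> hits F xs" "card A \<le> card B"
  shows "A \<subseteq> B"
  using set_take_subset_set_take[OF assms(3), of xs] assms(1,2) by (simp add: hits_def)

lemma hits_chain: "chain_subset (hits F xs)"
  unfolding chain_subset_def by (metis hits_nested nat_le_linear)

lemma hits_subset: "hits F xs \<subseteq> F"
  by (auto simp: hits_def)

lemma fact_split:
  assumes "p \<le> a" "a \<le> n"
  shows "fact (a - p) * fact (n - a) * ((n - p) choose (a - p)) = (fact (n - p) :: nat)"
  using binomial_fact_lemma[of "a - p" "n - p"] assms by simp

text \<open>Given its part up to \<^term>\<open>P\<close>, a random maximal chain continues uniformly above \<^term>\<open>P\<close>, so it
  meets \<^term>\<open>A\<close> with probability one over the number of sets of the size of \<^term>\<open>A\<close> that contain \<^term>\<open>P\<close>. The closure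
  hypothesis expresses that membership in \<^term>\<open>G\<close> is decided by the part up to \<^term>\<open>P\<close>.\<close>

lemma card_hitting_above:
  assumes V: "finite V" and G: "G \<subseteq> permutations_of_set V" and PA: "P \<subseteq> A" "A \<subseteq> V"
    and P: "\<And>xs. xs \<in> G \<Longrightarrow> set (take (card P) xs) = P"
    and closed: "\<And>xs ys. xs \<in> G \<Longrightarrow> ys \<in> permutations_of_set V \<Longrightarrow>
      take (card P) ys = take (card P) xs \<Longrightarrow> ys \<in> G"
  shows "card {xs \<in> G. set (take (card A) xs) = A} * ((card V - card P) choose (card A - card P)) = card G"
proof -
  let ?p = "card P"
  define H where "H = take ?p ` G"
  have fin: "finite A" "finite P" "finite G"
    using finite_subset[OF PA(2) V] finite_subset[OF PA(1)] finite_subset[OF G finite_permutations_of_set]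
    by auto
  have finH: "finite H" using fin by (simp add: H_def)
  have cards: "card P \<le> card A" "card A \<le> card V"
    using PA V fin by (auto intro: card_mono)
  have H: "set h = P" "distinct h" "length h = ?p" if hH: "h \<in> H" for h
  proof -
    obtain xs where xs: "xs \<in> G" "h = take ?p xs" using hH by (auto simp: H_def)
    then have "distinct xs" using G by (auto dest: permutations_of_setD)
    then show "distinct h" using xs by simp
    show "set h = P" using P xs by simp
    then show "length h = ?p" using \<open>distinct h\<close> distinct_card by metis
  qed
  have glue: "h @ t \<in> G" if ht: "h \<in> H" "t \<in> permutations_of_set (V - P)" for h t
  proof -
    obtain xs where xs: "xs \<in> G" "h = take ?p xs" using ht by (auto simp: H_def)
    have "h @ t \<in> permutations_of_set V"
      using H[OF ht(1)] permutations_of_setD[OF ht(2)] PA by (intro permutations_of_setI) auto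
    then show ?thesis using closed[OF xs(1)] xs(2) H(3)[OF ht(1)] by simp
  qed
  have split: "drop ?p xs \<in> permutations_of_set (V - P)" if "xs \<in> G" for xs
  proof (rule permutations_of_setI)
    have d: "distinct xs" "set xs = V" using that G by (auto dest: permutations_of_setD)
    then show "distinct (drop ?p xs)" by simp
    have "distinct (take ?p xs @ drop ?p xs)" "set (take ?p xs @ drop ?p xs) = V"
      using d by simp_all
    then show "set (drop ?p xs) = V - P"
      using P[OF that] by (auto simp del: append_take_drop_id)
  qed
  \<comment> \<open>A member of G is an initial part of length card P followed by any ordering of the rest.\<close>
  have Geq: "G = (\<lambda>(h, t). h @ t) ` (H \<times> permutations_of_set (V - P))"
  proof
    show "G \<subseteq> (\<lambda>(h, t). h @ t) ` (H \<times> permutations_of_set (V - P))"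
    proof
      fix xs assume "xs \<in> G"
      then have "(take ?p xs, drop ?p xs) \<in> H \<times> permutations_of_set (V - P)"
        using split by (auto simp: H_def)
      then show "xs \<in> (\<lambda>(h, t). h @ t) ` (H \<times> permutations_of_set (V - P))"
        by (rule rev_image_eqI) simp
    qed
  qed (use glue in auto)
  have "inj_on (\<lambda>(h, t). h @ t) (H \<times> permutations_of_set (V - P))"
    using H(3) by (auto simp: inj_on_def)
  then have cG: "card G = card H * fact (card V - card P)"
    using V PA fin finH by (subst Geq) (simp add: card_image card_cartesian_product card_Diff_subset)
  let ?S = "H \<times> (permutations_of_set (A - P) \<times> permutations_of_set (V - A))"
  have len: "length h + length s = card A"
    if "h \<in> H" "s \<in> permutations_of_set (A - P)" for h s
    using that H(3) fin PA cards by (simp add: length_finite_permutations_of_set card_Diff_subset)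
  have Aeq: "{xs \<in> G. set (take (card A) xs) = A} = (\<lambda>(h, s, t). h @ s @ t) ` ?S"
  proof
    show "{xs \<in> G. set (take (card A) xs) = A} \<subseteq> (\<lambda>(h, s, t). h @ s @ t) ` ?S"
    proof
      fix xs assume xs: "xs \<in> {xs \<in> G. set (take (card A) xs) = A}"
      let ?h = "take ?p xs" and ?s = "take (card A - ?p) (drop ?p xs)" and ?t = "drop (card A) xs"
      have d: "distinct xs" "set xs = V" using xs G by (auto dest: permutations_of_setD)
      have hs: "?h @ ?s = take (card A) xs"
        using cards by (metis le_add_diff_inverse take_add)
      then have "distinct (?h @ ?s)" "set (?h @ ?s) = A"
        using xs d by auto
      then have s: "?s \<in> permutations_of_set (A - P)"
        using P[of xs] xs by (intro permutations_of_setI) auto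
      have "distinct (take (card A) xs @ ?t)" "set (take (card A) xs @ ?t) = V"
        using d by simp_all
      then have t: "?t \<in> permutations_of_set (V - A)"
        using xs by (intro permutations_of_setI) (auto simp del: append_take_drop_id)
      have "xs = (?h @ ?s) @ ?t" unfolding hs by simp
      then have eq: "xs = ?h @ ?s @ ?t" by simp
      have "(?h, ?s, ?t) \<in> ?S"
        using s t xs by (auto simp: H_def)
      then show "xs \<in> (\<lambda>(h, s, t). h @ s @ t) ` ?S"
        by (rule rev_image_eqI) (use eq in simp)
    qed
    show "(\<lambda>(h, s, t). h @ s @ t) ` ?S \<subseteq> {xs \<in> G. set (take (card A) xs) = A}"
    proof (clarify, intro conjI)
      fix h s t assume hst: "h \<in> H" "s \<in> permutations_of_set (A - P)" "t \<in> permutations_of_set (V - A)"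
      have "s @ t \<in> permutations_of_set (V - P)"
        using permutations_of_setD[OF hst(2)] permutations_of_setD[OF hst(3)] PA
        by (intro permutations_of_setI) auto
      then show "h @ s @ t \<in> G" using glue hst(1) by blast
      have "take (card A) (h @ s @ t) = h @ s"
        using len[OF hst(1,2)] by simp
      then show "set (take (card A) (h @ s @ t)) = A"
        using H(1)[OF hst(1)] permutations_of_setD(1)[OF hst(2)] PA by auto
    qed
  qed
  have "inj_on (\<lambda>(h, s, t). h @ s @ t) ?S"
  proof (rule inj_onI)
    fix x y assume x: "x \<in> ?S" and y: "y \<in> ?S"
      and eq: "(\<lambda>(h, s, t). h @ s @ t) x = (\<lambda>(h, s, t). h @ s @ t) y"
    obtain h s t h' s' t' where xy: "x = (h, s, t)" "y = (h', s', t')"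
      by (metis prod_cases3)
    have *: "h \<in> H" "s \<in> permutations_of_set (A - P)" "h' \<in> H" "s' \<in> permutations_of_set (A - P)"
      using x y xy by auto
    have "length h = length h'" "length s = length s'"
      using H(3) * len[OF *(1,2)] len[OF *(3,4)] by auto
    then show "x = y" using eq xy by simp
  qed
  then have cA: "card {xs \<in> G. set (take (card A) xs) = A} =
      card H * (fact (card A - card P) * fact (card V - card A))"
    using V PA fin finH by (subst Aeq) (simp add: card_image card_cartesian_product card_Diff_subset)
  show ?thesis
    unfolding cA cG using fact_split[OF cards] by (simp add: mult.assoc)
qed

lemma card_hitting:
  assumes V: "finite V" and A: "A \<subseteq> V"
  shows "card {xs \<in> permutations_of_set V. set (take (card A) xs) = A} * (card V choose card A) = fact (card V)"
  using card_hitting_above[OF V order_refl empty_subsetI A] V by simp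

text \<open>Exchanging the entries at positions \<open>i < j\<close> changes the maximal chain exactly at the levels
  \<open>i + 1, \<dots>, j\<close>. This is the resampling step behind the bounds on hitting probabilities.\<close>

definition swap :: "nat \<Rightarrow> nat \<Rightarrow> 'a list \<Rightarrow> 'a list" where
  "swap i j xs = permute_list (transpose i j) xs"

context
  fixes i j :: nat and xs :: "'a list"
  assumes ij: "i < j" "j < length xs"
begin

lemma swap_permutes: "transpose i j permutes {..<length xs}"
  using ij by (intro permutes_swap_id) auto

lemma swap_nth: "l < length xs \<Longrightarrow> swap i j xs ! l = xs ! transpose i j l"
  unfolding swap_def by (rule permute_list_nth[OF swap_permutes])

lemma swap_swap: "swap i j (swap i j xs) = xs"
  unfolding swap_def
  using permute_list_compose[OF swap_permutes, of "transpose i j"] by simp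

lemma swap_in_permutations: "xs \<in> permutations_of_set V \<Longrightarrow> swap i j xs \<in> permutations_of_set V"
  unfolding swap_def permutations_of_set_def using swap_permutes by simp

lemma length_swap: "length (swap i j xs) = length xs"
  by (simp add: swap_def)

lemma set_take_swap:
  assumes "l \<le> i \<or> j < l"
  shows "set (take l (swap i j xs)) = set (take l xs)"
proof (cases "l \<le> length xs")
  case True
  have "set (take l (swap i j xs)) = (!) (swap i j xs) ` {0..<l}"
    using True by (simp add: nth_image length_swap)
  also have "\<dots> = (\<lambda>m. xs ! transpose i j m) ` {0..<l}"
    using True by (intro image_cong refl swap_nth) auto
  also have "\<dots> = (!) xs ` (transpose i j ` {0..<l})"
    by (simp add: image_image)
  also have "transpose i j ` {0..<l} = {0..<l}"
    using assms ij(1) by (intro transpose_image_eq) auto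
  also have "(!) xs ` {0..<l} = set (take l xs)"
    using True by (rule nth_image)
  finally show ?thesis .
next
  case False
  then show ?thesis
    using swap_permutes by (simp add: swap_def)
qed

lemma nth_in_set_take_swap:
  assumes "i < l" "l \<le> j"
  shows "xs ! j \<in> set (take l (swap i j xs))"
  using assms ij swap_nth[of i] by (auto simp: in_set_conv_nth length_swap intro!: exI[of _ i])

end

lemma nth_notin_set_take:
  assumes "distinct xs" "l \<le> j" "j < length xs"
  shows "xs ! j \<notin> set (take l xs)"
  using assms by (auto simp: in_set_conv_nth nth_eq_iff_index_eq)

text \<open>The exchange drops \<^term>\<open>A\<close>, and it picks up nothing: the new sets at the changed levels are still
  comparable with the hit \<^term>\<open>C\<close>, while \<^term>\<open>A\<close> is the only such member of \<^term>\<open>F\<close> at these levels.\<close>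

lemma hits_swap:
  assumes xs: "xs \<in> permutations_of_set V" and V: "finite V"
    and A: "A \<in> hits F xs" "i < card A" "card A \<le> j" "j < card V"
    and C: "C \<in> hits F xs" "card C \<le> i \<or> j < card C"
    and only: "\<And>W. W \<in> F \<Longrightarrow> i < card W \<Longrightarrow> card W \<le> j \<Longrightarrow> W \<subseteq> C \<or> C \<subseteq> W \<Longrightarrow> W = A"
  shows "hits F (swap i j xs) = hits F xs - {A}"
proof -
  have len: "length xs = card V" and d: "distinct xs"
    using xs V by (auto simp: length_finite_permutations_of_set dest: permutations_of_setD)
  have ij: "i < j" "j < length xs" using A len by auto
  have C': "C \<in> hits F (swap i j xs)"
    using C set_take_swap[OF ij, of "card C"] by (simp add: hits_def)
  have far: "W \<in> hits F (swap i j xs) \<longleftrightarrow> W \<in> hits F xs" if "card W \<le> i \<or> j < card W" for W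
    using set_take_swap[OF ij that] by (simp add: hits_def)
  have near: "W = A" if "W \<in> hits F ys" "C \<in> hits F ys" "i < card W" "card W \<le> j" for W ys
    using only[of W] that hits_chain[of F ys] by (auto simp: chain_subset_def dest: hitsD)
  have "A \<notin> hits F (swap i j xs)"
    using nth_in_set_take_swap[OF ij A(2,3)] nth_notin_set_take[OF d A(3) ij(2)] A(1)
    by (auto simp: hits_def)
  then have "W \<in> hits F (swap i j xs) \<longleftrightarrow> W \<in> hits F xs \<and> W \<noteq> A" for W
    using far[of W] near[of W, OF _ C'] near[of W, OF _ C(1)] A(2,3)
    by (cases "card W \<le> i \<or> j < card W") auto
  then show ?thesis by blast
qed

text \<open>Exchanging the last entry of \<^term>\<open>A\<close> with the next one maps the maximal chains through \<^term>\<open>A\<close>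
  injectively to maximal chains that miss \<^term>\<open>A\<close> and agree at all other levels. So \<^term>\<open>A\<close> is hit with
  probability at most one half, even after conditioning on the other hits.\<close>

lemma two_card_hit_le:
  assumes V: "finite V" and G: "G \<subseteq> permutations_of_set V"
    and A: "0 < card A" "card A < card V"
    and C: "\<And>xs. xs \<in> G \<Longrightarrow> C \<in> hits F xs" "card C \<noteq> card A"
    and only: "\<And>W. W \<in> F \<Longrightarrow> card W = card A \<Longrightarrow> W \<subseteq> C \<or> C \<subseteq> W \<Longrightarrow> W = A"
    and closed: "\<And>xs ys. xs \<in> G \<Longrightarrow> A \<in> hits F xs \<Longrightarrow> ys \<in> permutations_of_set V \<Longrightarrow>
      hits F ys = hits F xs - {A} \<Longrightarrow> ys \<in> G"
  shows "2 * card {xs \<in> G. A \<in> hits F xs} \<le> card G"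
proof -
  let ?i = "card A - 1" and ?j = "card A"
  let ?H = "{xs \<in> G. A \<in> hits F xs}"
  have fin: "finite G" using G finite_permutations_of_set finite_subset by blast
  have len: "length xs = card V" if "xs \<in> G" for xs
    using that G length_finite_permutations_of_set by blast
  have ij: "?i < ?j" "?j < card V" using A by auto
  have hs: "hits F (swap ?i ?j xs) = hits F xs - {A}" if "xs \<in> ?H" for xs
    using that G A C by (intro hits_swap[where V = V and C = C] V only) auto
  have sub: "swap ?i ?j ` ?H \<subseteq> {xs \<in> G. A \<notin> hits F xs}"
  proof
    fix ys assume "ys \<in> swap ?i ?j ` ?H"
    then obtain xs where xs: "xs \<in> ?H" "ys = swap ?i ?j xs" by blast
    have "ys \<in> permutations_of_set V"
      using swap_in_permutations[OF ij(1), of xs V] xs len G ij(2) by auto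
    then show "ys \<in> {xs \<in> G. A \<notin> hits F xs}"
      using closed[of xs ys] xs hs[OF xs(1)] by auto
  qed
  have "swap ?i ?j (swap ?i ?j xs) = xs" if "xs \<in> G" for xs
    using ij len[OF that] by (intro swap_swap) auto
  then have "inj_on (swap ?i ?j) ?H"
    by (intro inj_on_inverseI[of _ "swap ?i ?j"]) auto
  then have "card ?H = card (swap ?i ?j ` ?H)" by (simp add: card_image)
  also have "\<dots> \<le> card {xs \<in> G. A \<notin> hits F xs}" using sub fin by (intro card_mono) auto
  finally have "card ?H \<le> card {xs \<in> G. A \<notin> hits F xs}" .
  moreover have "card ?H + card {xs \<in> G. A \<notin> hits F xs} = card G"
    using fin by (subst card_Un_disjoint[symmetric]) (auto intro!: arg_cong[where f = card])
  ultimately show ?thesis by linarith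
qed

text \<open>If the level just below \<^term>\<open>A\<close> is free as well, then either of the last two entries of \<^term>\<open>A\<close> may
  be exchanged with the next entry. Both maps are injective and their images are disjoint from each
  other and from the chains through \<^term>\<open>A\<close>, which bounds the probability by one third.\<close>

lemma three_card_hit_le:
  assumes V: "finite V" and G: "G \<subseteq> permutations_of_set V"
    and A: "2 \<le> card A" "card A < card V"
    and C: "\<And>xs. xs \<in> G \<Longrightarrow> C \<in> hits F xs" "card A < card C"
    and only: "\<And>W. W \<in> F \<Longrightarrow> card A - 1 \<le> card W \<Longrightarrow> card W \<le> card A \<Longrightarrow> W \<subseteq> C \<Longrightarrow> W = A"
    and closed: "\<And>xs ys. xs \<in> G \<Longrightarrow> A \<in> hits F xs \<Longrightarrow> ys \<in> permutations_of_set V \<Longrightarrow>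
      hits F ys = hits F xs - {A} \<Longrightarrow> ys \<in> G"
  shows "3 * card {xs \<in> G. A \<in> hits F xs} \<le> card G"
proof -
  let ?j = "card A"
  let ?H = "{xs \<in> G. A \<in> hits F xs}"
  let ?T = "\<lambda>b. {ys \<in> G. A \<notin> hits F ys \<and> (ys ! (?j - 2) \<in> A \<longleftrightarrow> b)}"
  have fin: "finite G" using G finite_permutations_of_set finite_subset by blast
  have len: "length xs = card V" "distinct xs" if "xs \<in> G" for xs
    using that G V by (auto simp: length_finite_permutations_of_set dest: permutations_of_setD)
  \<comment> \<open>The levels changed by either exchange are those of card A - 1 and card A, or the latter alone.\<close>
  have only': "W = A" if "W \<in> F" "i < card W" "card W \<le> ?j" "W \<subseteq> C \<or> C \<subseteq> W" "i \<ge> ?j - 2"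
    for W i
  proof -
    have "\<not> C \<subseteq> W"
    proof
      assume "C \<subseteq> W"
      moreover have "finite W" using that(2) card.infinite by fastforce
      ultimately show False using card_mono[of W C] C(2) that(3) by linarith
    qed
    then show ?thesis using only that A by auto
  qed
  have main: "card ?H \<le> card (?T b)" if i: "i < ?j" "?j - 2 \<le> i" and b: "b \<longleftrightarrow> i = ?j - 1" for i b
  proof -
    have hs: "hits F (swap i ?j xs) = hits F xs - {A}" if "xs \<in> ?H" for xs
      using that G A C i by (intro hits_swap[where V = V and C = C] V only'[of _ i]) auto
    have sub: "swap i ?j ` ?H \<subseteq> ?T b"
    proof
      fix ys assume "ys \<in> swap i ?j ` ?H"
      then obtain xs where xs: "xs \<in> ?H" "ys = swap i ?j xs" by blast
      have lx: "length xs = card V" "distinct xs" using len xs by auto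
      then have jl: "?j < length xs" using A by simp
      have "ys \<in> permutations_of_set V"
        using swap_in_permutations[OF i(1) jl] xs G by auto
      then have G': "ys \<in> G" "A \<notin> hits F ys"
        using closed[of xs ys] xs hs[OF xs(1)] by auto
      have Aset: "set (take ?j xs) = A" using xs by (auto dest: hitsD)
      \<comment> \<open>The entry at position card A - 2 stays in A under the short exchange and leaves A under the long one.\<close>
      have "ys ! (?j - 2) = xs ! transpose i ?j (?j - 2)"
        unfolding xs(2) using jl A by (intro swap_nth[OF i(1) jl]) auto
      also have "\<dots> \<in> A \<longleftrightarrow> b"
      proof (cases "i = ?j - 1")
        case True
        then have "transpose i ?j (?j - 2) = ?j - 2" using A by (intro transpose_apply_other) auto
        moreover have "xs ! (?j - 2) \<in> set (take ?j xs)"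
          using jl A by (auto simp: in_set_conv_nth intro!: exI[of _ "?j - 2"])
        ultimately show ?thesis using b True Aset by simp
      next
        case False
        then have "i = ?j - 2" using i by linarith
        then show ?thesis using b False Aset nth_notin_set_take[OF lx(2) order_refl jl] by simp
      qed
      finally show "ys \<in> ?T b" using G' by simp
    qed
    have "swap i ?j (swap i ?j xs) = xs" if "xs \<in> G" for xs
      using i(1) A len[OF that] by (intro swap_swap) auto
    then have "inj_on (swap i ?j) ?H"
      by (intro inj_on_inverseI[of _ "swap i ?j"]) auto
    then have "card ?H = card (swap i ?j ` ?H)" by (simp add: card_image)
    also have "\<dots> \<le> card (?T b)" using sub fin by (intro card_mono) auto
    finally show ?thesis .
  qed
  have "G = ?H \<union> ?T True \<union> ?T False" by auto
  then have "card G = card (?H \<union> ?T True \<union> ?T False)" by (rule arg_cong)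
  also have "\<dots> = card ?H + card (?T True) + card (?T False)"
    using fin by (subst card_Un_disjoint; (subst card_Un_disjoint)?) auto
  finally have "card G = card ?H + card (?T True) + card (?T False)" .
  moreover have "card ?H \<le> card (?T True)"
    using A by (intro main[of "?j - 1"]) auto
  moreover have "card ?H \<le> card (?T False)"
    using A by (intro main[of "?j - 2"]) auto
  ultimately show ?thesis by linarith
qed

section \<open>Averaging over classes of maximal chains\<close>

lemma sum_over_hits:
  fixes w :: "'a set \<Rightarrow> real"
  assumes "finite G" "finite L"
  shows "(\<Sum>xs\<in>G. \<Sum>A\<in>{A\<in>L. A \<in> hits F xs}. w A) = (\<Sum>A\<in>L. w A * real (card {xs \<in> G. A \<in> hits F xs}))"
  using sum.swap_restrict[OF assms, of "\<lambda>_. w" "\<lambda>xs A. A \<in> hits F xs"] by (simp add: mult.commute)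

lemma sum_card_over_hits:
  assumes "finite G" "finite L"
  shows "(\<Sum>xs\<in>G. real (card {A\<in>L. A \<in> hits F xs})) = (\<Sum>A\<in>L. real (card {xs \<in> G. A \<in> hits F xs}))"
  using sum_over_hits[OF assms, where F = F and w = "\<lambda>_. 1"] by simp

lemma sum_le_fibrewise:
  fixes g :: "'a \<Rightarrow> real"
  assumes "finite S"
    and "\<And>y. sum g {x \<in> S. f x = y} \<le> c * real (card {x \<in> S. f x = y})"
  shows "sum g S \<le> c * real (card S)"
proof -
  have "sum g S = (\<Sum>y\<in>f ` S. sum g {x \<in> S. f x = y})"
    using assms(1) by (rule sum.image_gen)
  also have "\<dots> \<le> (\<Sum>y\<in>f ` S. c * real (card {x \<in> S. f x = y}))"
    by (intro sum_mono assms(2))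
  also have "\<dots> = (\<Sum>y\<in>f ` S. \<Sum>x\<in>{x \<in> S. f x = y}. c)"
    by (simp add: mult.commute)
  also have "\<dots> = c * real (card S)"
    using sum.image_gen[OF assms(1), of "\<lambda>_. c" f] by (simp add: mult.commute)
  finally show ?thesis .
qed

lemma binomial_ge_inner:
  assumes "a \<le> i" "i + a \<le> d"
  shows "d choose a \<le> d choose i"
proof (cases "2 * i \<le> d")
  case True
  then show ?thesis using binomial_mono[of a i d] assms by simp
next
  case False
  then have "d choose a \<le> d choose (d - i)"
    using assms by (intro binomial_mono) auto
  then show ?thesis using assms binomial_symmetric[of i d] by simp
qed

text \<open>The expected number of hits of a random maximal chain strictly inside an interval of height
  \<^term>\<open>d\<close>, when one set is prescribed on every inner level: the most that a chain of members above a
  given set can contribute.\<close>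

definition inverse_binomial_sum :: "nat \<Rightarrow> real" where
  "inverse_binomial_sum d = (\<Sum>i\<in>{1..<d}. 1 / real (d choose i))"

lemma inverse_binomial_sum_le:
  assumes "1 \<le> d"
  shows "inverse_binomial_sum d \<le> 1 - 1 / real d"
proof -
  have "inverse_binomial_sum d \<le> (\<Sum>i\<in>{1..<d}. 1 / real d)"
    unfolding inverse_binomial_sum_def
  proof (rule sum_mono)
    fix i assume "i \<in> {1..<d}"
    then have "d \<le> d choose i" using binomial_ge_inner[of 1 i d] by simp
    then show "1 / real (d choose i) \<le> 1 / real d"
      using assms by (intro frac_le) auto
  qed
  also have "\<dots> = 1 - 1 / real d"
    using assms by (simp add: of_nat_diff field_simps)
  finally show ?thesis .
qed

text \<open>The bound is attained for \<^term>\<open>d = 3\<close> and for \<^term>\<open>d = 4\<close>. From there on the two outer terms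
  contribute \<open>2 / d\<close> and each inner term at most one over \<open>d choose 2\<close>.\<close>

lemma inverse_binomial_sum_le_two_thirds: "inverse_binomial_sum d \<le> 2 / 3"
proof -
  consider "d = 0" | "d \<in> {1, 2, 3}" | "4 \<le> d" by fastforce
  then show ?thesis
  proof cases
    case 2
    have "inverse_binomial_sum d \<le> 1 - 1 / real d"
      using 2 by (intro inverse_binomial_sum_le) auto
    then show ?thesis using 2 by auto
  next
    case 3
    have split: "{1..<d} = insert 1 (insert (d - 1) {2..<d - 1})" using 3 by auto
    have "inverse_binomial_sum d = 1 / real d + (1 / real d + (\<Sum>i\<in>{2..<d - 1}. 1 / real (d choose i)))"
      unfolding inverse_binomial_sum_def split using 3 binomial_symmetric[of 1 d] by simp
    also have "(\<Sum>i\<in>{2..<d - 1}. 1 / real (d choose i)) \<le> (\<Sum>i\<in>{2..<d - 1}. 1 / real (d choose 2))"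
    proof (rule sum_mono)
      fix i assume "i \<in> {2..<d - 1}"
      then have "d choose 2 \<le> d choose i" by (intro binomial_ge_inner) auto
      moreover have "0 < d choose 2" using 3 by simp
      ultimately show "1 / real (d choose i) \<le> 1 / real (d choose 2)"
        by (intro frac_le) auto
    qed
    also have "\<dots> = (real d - 3) / real (d choose 2)" using 3 by (simp add: of_nat_diff)
    also have "real (d choose 2) = real d * (real d - 1) / 2"
      using 3 by (simp add: choose_two real_of_nat_div of_nat_diff)
    finally have "inverse_binomial_sum d \<le> 2 / real d + (real d - 3) / (real d * (real d - 1) / 2)"
      by simp
    also have "\<dots> = 2 / 3 - 2 * ((real d - 3) * (real d - 4)) / (3 * (real d * (real d - 1)))"
      using 3 by (simp add: divide_simps) (simp add: algebra_simps)
    also have "\<dots> \<le> 2 / 3"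
      using 3 by simp
    finally show ?thesis .
  qed (simp add: inverse_binomial_sum_def)
qed

lemma inj_on_card_chain:
  assumes "chain_subset K" "\<And>X. X \<in> K \<Longrightarrow> finite X"
  shows "inj_on card K"
  using assms unfolding chain_subset_def by (metis card_subset_eq inj_onI)

text \<open>Maximal chains are classified by their lowest hit in a subfamily \<^term>\<open>S\<close>, which is the intersection
  of their hits in \<^term>\<open>S\<close>. The class of \<^term>\<open>A\<close> is determined by the part of the maximal chain up to
  \<^term>\<open>A\<close>, so that the part above \<^term>\<open>A\<close> remains uniformly distributed.\<close>

definition lowest_class :: "'a set \<Rightarrow> 'a set set \<Rightarrow> 'a set set \<Rightarrow> 'a set \<Rightarrow> 'a list set" where
  "lowest_class V F S A = {xs \<in> permutations_of_set V. S \<inter> hits F xs \<noteq> {} \<and> \<Inter>(S \<inter> hits F xs) = A}"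

lemma lowest_classD:
  assumes "finite F" "xs \<in> lowest_class V F S A"
  shows "xs \<in> permutations_of_set V" "A \<in> S" "A \<in> hits F xs"
    "\<And>X. X \<in> S \<Longrightarrow> X \<in> hits F xs \<Longrightarrow> A \<subseteq> X"
proof -
  have xs: "xs \<in> permutations_of_set V" "S \<inter> hits F xs \<noteq> {}" "\<Inter>(S \<inter> hits F xs) = A"
    using assms(2) by (auto simp: lowest_class_def)
  have "\<Inter>(S \<inter> hits F xs) \<in> S \<inter> hits F xs"
    using assms(1) xs(2) finite_subset[OF hits_subset[of F xs]] hits_chain[of F xs]
    by (intro chain_Inter_mem) (auto intro: chain_subset_mono)
  then show "xs \<in> permutations_of_set V" "A \<in> S" "A \<in> hits F xs"
    "\<And>X. X \<in> S \<Longrightarrow> X \<in> hits F xs \<Longrightarrow> A \<subseteq> X"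
    using xs by auto
qed

lemma lowest_classI:
  assumes "xs \<in> permutations_of_set V" "A \<in> S" "A \<in> hits F xs"
    "\<And>X. X \<in> S \<Longrightarrow> X \<in> hits F xs \<Longrightarrow> A \<subseteq> X"
  shows "xs \<in> lowest_class V F S A"
  using assms unfolding lowest_class_def by blast

text \<open>The members above \<^term>\<open>A\<close> form a chain of proper subsets of \<^term>\<open>V\<close>, so they lie on distinct
  levels and each of them is hit with probability one over a binomial coefficient.\<close>

lemma sum_hits_above_le:
  assumes V: "finite V" and F: "F \<subseteq> Pow V" "V \<notin> F"
    and ch: "chain_subset {B \<in> F. A \<subset> B}"
    and G_def: "G = lowest_class V F S A"
  shows "(\<Sum>xs\<in>G. real (card {B \<in> hits F xs. A \<subset> B}))
    \<le> inverse_binomial_sum (card V - card A) * real (card G)"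
proof (cases "G = {}")
  case False
  let ?d = "card V - card A" and ?L = "{B \<in> F. A \<subset> B}"
  have finF: "finite F" using V F finite_subset by blast
  note GD = lowest_classD[OF finF, of _ V S A, folded G_def]
  have G: "G \<subseteq> permutations_of_set V" using GD(1) by blast
  then have finG: "finite G" using finite_permutations_of_set finite_subset by blast
  obtain xs0 where xs0: "xs0 \<in> G" using False by blast
  then have A: "A \<in> F" "finite A" using GD(3) hitsD F V by (blast, meson PowD V finite_subset hitsD(1) subset_iff)
  have fin: "finite B" "B \<subseteq> V" "B \<noteq> V" if "B \<in> F" for B
    using that F V finite_subset by blast+
  have closed: "ys \<in> G" if xs: "xs \<in> G" and ys: "ys \<in> permutations_of_set V"
    and eq: "take (card A) ys = take (card A) xs" for xs ys
  proof -
    have same: "X \<in> hits F ys \<longleftrightarrow> X \<in> hits F xs" if "card X \<le> card A" for X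
    proof -
      have "take (card X) zs = take (card X) (take (card A) zs)" for zs :: "'a list"
        using that by (simp add: min_def)
      then have "take (card X) ys = take (card X) xs" using eq by metis
      then show ?thesis by (simp add: hits_def)
    qed
    show ?thesis unfolding G_def
    proof (rule lowest_classI[OF ys])
      show "A \<in> S" "A \<in> hits F ys" using GD[OF xs] same by auto
      fix X assume X: "X \<in> S" "X \<in> hits F ys"
      show "A \<subseteq> X"
      proof (cases "card X \<le> card A")
        case True
        then show ?thesis using same X GD(4)[OF xs] by blast
      next
        case False
        then show ?thesis using hits_nested[OF \<open>A \<in> hits F ys\<close> X(2)] by simp
      qed
    qed
  qed
  have each: "real (card {xs \<in> G. B \<in> hits F xs}) = 1 / real (?d choose (card B - card A)) * real (card G)"
    if B: "B \<in> ?L" for B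
  proof -
    have "card {xs \<in> G. set (take (card B) xs) = B} * (?d choose (card B - card A)) = card G"
      using B fin hitsD(2)[OF GD(3)] by (intro card_hitting_above[OF V G _ _ _ closed]) auto
    moreover have "{xs \<in> G. set (take (card B) xs) = B} = {xs \<in> G. B \<in> hits F xs}"
      using B by (auto simp: hits_def)
    moreover have "card B \<le> card V" using fin(2) B by (intro card_mono[OF V]) auto
    then have "0 < ?d choose (card B - card A)" by (simp add: diff_le_mono)
    ultimately show ?thesis by (auto simp: field_simps simp flip: of_nat_mult)
  qed
  have "inj_on card ?L" using ch fin by (intro inj_on_card_chain) auto
  moreover have "card A \<le> card B" if "B \<in> ?L" for B
    using that fin by (auto intro: card_mono)
  ultimately have inj: "inj_on (\<lambda>B. card B - card A) ?L"
    by (simp add: inj_on_def eq_diff_iff)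
  have range: "(\<lambda>B. card B - card A) ` ?L \<subseteq> {1..<?d}"
  proof (rule image_subsetI)
    fix B assume "B \<in> ?L"
    then have "card A < card B" "card B < card V"
      using fin V psubset_card_mono[of B A] psubset_card_mono[of V B] by blast+
    then show "card B - card A \<in> {1..<?d}" by auto
  qed
  have "(\<Sum>xs\<in>G. real (card {B \<in> hits F xs. A \<subset> B})) = (\<Sum>xs\<in>G. real (card {B\<in>?L. B \<in> hits F xs}))"
    by (intro sum.cong refl arg_cong[where f = "\<lambda>S. real (card S)"]) (auto simp: hits_def)
  also have "\<dots> = (\<Sum>B\<in>?L. real (card {xs \<in> G. B \<in> hits F xs}))"
    using finG finF by (intro sum_card_over_hits) auto
  also have "\<dots> = (\<Sum>B\<in>?L. 1 / real (?d choose (card B - card A))) * real (card G)"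
    unfolding sum_distrib_right using each by (intro sum.cong) auto
  also have "(\<Sum>B\<in>?L. 1 / real (?d choose (card B - card A))) = (\<Sum>i\<in>(\<lambda>B. card B - card A) ` ?L. 1 / real (?d choose i))"
    using sum.reindex[OF inj, of "\<lambda>i. 1 / real (?d choose i)"] by (simp add: comp_def)
  also have "\<dots> \<le> inverse_binomial_sum ?d"
    unfolding inverse_binomial_sum_def using range by (intro sum_mono2) auto
  finally show ?thesis by (simp add: mult_right_mono)
qed simp

section \<open>Families whose chains do not fork\<close>

text \<open>What remains of the two forbidden posets is that no fork opens above a top and none below a
  bottom. The members that are both tops and bottoms are comparable with a single chain only; they
  need separate treatment, because a maximal chain may meet arbitrarily many of them.\<close>

locale fork_free_family =
  fixes n k :: nat and F :: "nat set set"
  assumes k: "2 \<le> k"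
    and sets: "F \<subseteq> Pow {1..n}" and proper: "{} \<notin> F" "{1..n} \<notin> F"
    and above_chain: "\<And>A. A \<in> tops k F \<Longrightarrow> chain_subset {B \<in> F. A \<subset> B}"
    and below_chain: "\<And>A. A \<in> bottoms k F \<Longrightarrow> chain_subset {B \<in> F. B \<subset> A}"
begin

abbreviation "orders \<equiv> permutations_of_set {1..n}"
abbreviation "U \<equiv> tops k F"
abbreviation "D \<equiv> bottoms k F"

lemma finite_F: "finite F"
  using sets finite_subset by blast

lemma finite_hits: "finite (hits F xs)"
  using finite_F finite_subset[OF hits_subset] by blast

lemma member: "A \<in> F \<Longrightarrow> finite A" "A \<in> F \<Longrightarrow> 0 < card A" "A \<in> F \<Longrightarrow> card A < card {1..n}"
proof -
  assume A: "A \<in> F"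
  then show fin: "finite A" using sets finite_subset by blast
  show "0 < card A" using A fin proper by (metis card_gt_0_iff)
  have "A \<subset> {1..n}" using A sets proper by blast
  then show "card A < card {1..n}" by (intro psubset_card_mono) auto
qed

lemma same_card_eq:
  assumes "chain_subset K" "X \<in> K" "Y \<in> K" "X \<in> F" "Y \<in> F" "card X = card Y"
  shows "X = Y"
  using assms member(1) unfolding chain_subset_def by (metis card_subset_eq)

lemma card_less: "X \<in> F \<Longrightarrow> Y \<in> F \<Longrightarrow> X \<subset> Y \<Longrightarrow> card X < card Y"
  using member(1) by (intro psubset_card_mono) auto

lemma tops_subset: "U \<subseteq> F" and bottoms_subset: "D \<subseteq> F"
  by (auto simp: tops_def bottoms_def)

lemma Union_hits_mem: "S \<inter> hits F xs \<noteq> {} \<Longrightarrow> \<Union>(S \<inter> hits F xs) \<in> S \<inter> hits F xs"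
  using finite_hits hits_chain by (intro chain_Union_mem) (auto intro: chain_subset_mono)

lemma Inter_hits_mem: "S \<inter> hits F xs \<noteq> {} \<Longrightarrow> \<Inter>(S \<inter> hits F xs) \<in> S \<inter> hits F xs"
  using finite_hits hits_chain by (intro chain_Inter_mem) (auto intro: chain_subset_mono)

text \<open>A maximal chain with at least \<^term>\<open>k\<close> hits has its highest hit among the tops and its lowest
  hit among the bottoms.\<close>

lemma few_hits:
  assumes "U \<inter> hits F xs = {} \<or> D \<inter> hits F xs = {}"
  shows "card (hits F xs) < k"
proof (cases "hits F xs = {}")
  case False
  have "\<Union>(hits F xs) \<notin> U \<or> \<Inter>(hits F xs) \<notin> D"
    using chain_Union_mem[OF finite_hits False hits_chain] chain_Inter_mem[OF finite_hits False hits_chain]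
      assms by blast
  then show ?thesis
    using card_chain_less_if_Union_not_top[OF finite_hits hits_chain hits_subset False]
      card_chain_less_if_Inter_not_bottom[OF finite_hits hits_chain hits_subset False] by blast
qed (use k in simp)

text \<open>Maximal chains that avoid the members which are both top and bottom, but meet tops and
  bottoms, are classified by their highest bottom \<^term>\<open>P\<close> and their lowest top \<^term>\<open>Q\<close>.\<close>

definition middle_class :: "nat set \<Rightarrow> nat set \<Rightarrow> nat list set" where
  "middle_class P Q = {xs \<in> orders. U \<inter> D \<inter> hits F xs = {} \<and> D \<inter> hits F xs \<noteq> {} \<and> U \<inter> hits F xs \<noteq> {} \<and>
     \<Union>(D \<inter> hits F xs) = P \<and> \<Inter>(U \<inter> hits F xs) = Q}"

text \<open>Here \<open>P \<subset> Q\<close>, the members below \<open>P\<close> form a chain of some length \<open>p\<close>, and those above \<open>Q\<close> a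
  chain of some length \<open>q\<close>. If \<open>s\<close> hits lie between \<open>P\<close> and \<open>Q\<close> inclusively, then all members below \<open>P\<close>
  together with these hits except \<open>Q\<close> form a chain that stops below the tops, so \<open>s + p \<le> k\<close>; dually
  \<open>s + q \<le> k\<close>. The \<open>p + q\<close> outer members are hit with probability at most one half each, so the
  average number of hits is at most \<open>s + (p + q) / 2 \<le> k\<close>.\<close>

lemma middle_class_sum:
  "(\<Sum>xs\<in>middle_class P Q. real (card (hits F xs))) \<le> real k * real (card (middle_class P Q))"
proof (cases "middle_class P Q = {}")
  case False
  let ?G = "middle_class P Q"
  let ?L = "{X \<in> F. X \<subset> P}" and ?R = "{X \<in> F. Q \<subset> X}"
  have G: "?G \<subseteq> orders" by (auto simp: middle_class_def)
  then have finG: "finite ?G" using finite_permutations_of_set finite_subset by blast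
  have finLR: "finite ?L" "finite ?R" using finite_F by auto
  have PQ_hit: "P \<in> D" "P \<in> hits F xs" "Q \<in> U" "Q \<in> hits F xs" if "xs \<in> ?G" for xs
    using that Union_hits_mem[of D xs] Inter_hits_mem[of U xs] by (auto simp: middle_class_def)
  obtain xs0 where xs0: "xs0 \<in> ?G" using False by blast
  have P: "P \<in> D" "P \<in> F" and Q: "Q \<in> U" "Q \<in> F"
    using PQ_hit[OF xs0] tops_subset bottoms_subset by auto
  have not_both: "P \<notin> U" "Q \<notin> D"
    using xs0 PQ_hit[OF xs0] by (auto simp: middle_class_def)
  have "\<not> Q \<subseteq> P" using bottoms_downward[OF P(1) Q(2)] not_both by blast
  then have PQ: "P \<subset> Q"
    using PQ_hit[OF xs0] hits_chain[of F xs0] unfolding chain_subset_def by blast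
  have Lchain: "chain_subset ?L" and Rchain: "chain_subset ?R"
    using above_chain[OF Q(1)] below_chain[OF P(1)] by auto
  \<comment> \<open>Losing an outer hit does not change the pair (P, Q), so resampling stays inside the class.\<close>
  have stable: "ys \<in> ?G"
    if xs: "xs \<in> ?G" and ys: "ys \<in> orders" "hits F ys = hits F xs - {X}"
      and X: "X \<in> ?L \<or> X \<in> ?R" for xs ys X
  proof -
    have bounds: "Q \<subseteq> Y" if "Y \<in> U \<inter> hits F xs" for Y
      using xs that by (auto simp: middle_class_def)
    have bounds': "Y \<subseteq> P" if "Y \<in> D \<inter> hits F xs" for Y
      using xs that by (auto simp: middle_class_def)
    have "P \<noteq> X" "Q \<noteq> X" using X PQ by auto
    then have mem: "P \<in> D \<inter> hits F ys" "Q \<in> U \<inter> hits F ys"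
      using PQ_hit[OF xs] ys(2) by auto
    have sub: "U \<inter> hits F ys \<subseteq> U \<inter> hits F xs" "D \<inter> hits F ys \<subseteq> D \<inter> hits F xs"
      using ys(2) by auto
    have "\<Union>(D \<inter> hits F ys) = P"
      using mem(1) sub(2) bounds' by (intro subset_antisym Union_least Union_upper) blast+
    moreover have "\<Inter>(U \<inter> hits F ys) = Q"
      using mem(2) sub(1) bounds by (intro subset_antisym Inter_greatest Inter_lower) blast+
    moreover have "U \<inter> D \<inter> hits F xs = {}" using xs by (simp add: middle_class_def)
    then have "U \<inter> D \<inter> hits F ys = {}" using sub by blast
    ultimately show ?thesis
      using ys(1) mem unfolding middle_class_def by (intro CollectI conjI) blast+
  qed
  have half: "2 * card {xs \<in> ?G. X \<in> hits F xs} \<le> card ?G" if X: "X \<in> ?L" for X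
  proof (rule two_card_hit_le[where V = "{1..n}" and C = P])
    show "card P \<noteq> card X" using card_less[of X P] X P by auto
    fix W assume W: "W \<in> F" "card W = card X" "W \<subseteq> P \<or> P \<subseteq> W"
    have "W \<subset> P"
      using W card_less[of X P] X P card_mono[of W P] member(1)[of W] by (metis (no_types, lifting) leD mem_Collect_eq psubsetI)
    then show "W = X" using same_card_eq[OF Lchain, of W X] W X by auto
  qed (use X G member PQ_hit stable in auto)
  have half': "2 * card {xs \<in> ?G. X \<in> hits F xs} \<le> card ?G" if X: "X \<in> ?R" for X
  proof (rule two_card_hit_le[where V = "{1..n}" and C = Q])
    show "card Q \<noteq> card X" using card_less[of Q X] X Q by auto
    fix W assume W: "W \<in> F" "card W = card X" "W \<subseteq> Q \<or> Q \<subseteq> W"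
    have "Q \<subset> W"
      using W card_less[of Q X] X Q card_mono[of Q W] member(1)[of Q] by (metis (no_types, lifting) leD mem_Collect_eq psubsetI)
    then show "W = X" using same_card_eq[OF Rchain, of W X] W X by auto
  qed (use X G member PQ_hit stable in auto)
  have pointwise: "2 * card (hits F xs) + card ?L + card ?R \<le>
      2 * k + 2 * card {X\<in>?L. X \<in> hits F xs} + 2 * card {X\<in>?R. X \<in> hits F xs}" if xs: "xs \<in> ?G" for xs
  proof -
    let ?h = "hits F xs"
    let ?M = "{X \<in> ?h. P \<subseteq> X \<and> X \<subseteq> Q}"
    note hit = PQ_hit[OF xs]
    have comp: "X \<subseteq> Y \<or> Y \<subseteq> X" if "X \<in> ?h" "Y \<in> ?h" for X Y
      using hits_chain[of F xs] that unfolding chain_subset_def by blast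
    have Mchain: "chain_subset ?M" using hits_chain by (rule chain_subset_mono) auto
    have Qlow: "\<And>Y. Y \<in> U \<Longrightarrow> Y \<in> ?h \<Longrightarrow> Q \<subseteq> Y" and Phigh: "\<And>Y. Y \<in> D \<Longrightarrow> Y \<in> ?h \<Longrightarrow> Y \<subseteq> P"
      using xs by (auto simp: middle_class_def)
    have "?h = {X\<in>?L. X \<in> ?h} \<union> ?M \<union> {X\<in>?R. X \<in> ?h}"
    proof -
      have "X \<in> {X\<in>?L. X \<in> ?h} \<union> ?M \<union> {X\<in>?R. X \<in> ?h}" if "X \<in> ?h" for X
        using comp[OF that hit(2)] comp[OF that hit(4)] that hitsD(1)[OF that] by blast
      then show ?thesis by blast
    qed
    then have "card ?h = card ({X\<in>?L. X \<in> ?h} \<union> ?M \<union> {X\<in>?R. X \<in> ?h})"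
      by (rule arg_cong)
    also have "\<dots> \<le> card ({X\<in>?L. X \<in> ?h} \<union> ?M) + card {X\<in>?R. X \<in> ?h}"
      by (rule card_Un_le)
    also have "\<dots> \<le> card {X\<in>?L. X \<in> ?h} + card ?M + card {X\<in>?R. X \<in> ?h}"
      by (intro add_right_mono card_Un_le)
    finally have "card ?h \<le> card {X\<in>?L. X \<in> ?h} + card ?M + card {X\<in>?R. X \<in> ?h}" .
    moreover have "card ?L + card ?M \<le> k"
    proof -
      let ?K = "?L \<union> (?M - {Q})"
      have ch: "chain_subset ?K"
        using Lchain Mchain by (intro chain_subset_Un) (auto intro: chain_subset_mono)
      have fin: "finite ?K" using finLR finite_hits by auto
      have sub: "?K \<subseteq> F" by (auto dest: hitsD)
      have PK: "P \<in> ?K" using hit PQ by auto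
      then have ne: "?K \<noteq> {}" by blast
      have "\<Union>?K \<notin> U"
      proof
        assume U: "\<Union>?K \<in> U"
        have "P \<subseteq> \<Union>?K" using PK by blast
        then have "\<Union>?K \<in> ?M - {Q}" using chain_Union_mem[OF fin ne ch] by blast
        then show False using Qlow[OF U] by blast
      qed
      then have "card ?K < k"
        using card_chain_less_if_Union_not_top[OF fin ch sub ne] by blast
      moreover have "card ?K = card ?L + (card ?M - 1)"
        using finLR finite_hits hit PQ by (subst card_Un_disjoint) auto
      moreover have "0 < card ?M" using finite_hits hit PQ by (auto simp: card_gt_0_iff)
      ultimately show ?thesis by linarith
    qed
    moreover have "card ?R + card ?M \<le> k"
    proof -
      let ?K = "?R \<union> (?M - {P})"
      have ch: "chain_subset ?K"
        using Rchain Mchain by (subst Un_commute, intro chain_subset_Un) (auto intro: chain_subset_mono)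
      have fin: "finite ?K" using finLR finite_hits by auto
      have sub: "?K \<subseteq> F" by (auto dest: hitsD)
      have QK: "Q \<in> ?K" using hit PQ by auto
      then have ne: "?K \<noteq> {}" by blast
      have "\<Inter>?K \<notin> D"
      proof
        assume D: "\<Inter>?K \<in> D"
        have "\<Inter>?K \<subseteq> Q" using QK by blast
        then have "\<Inter>?K \<in> ?M - {P}" using chain_Inter_mem[OF fin ne ch] by blast
        then show False using Phigh[OF D] by blast
      qed
      then have "card ?K < k"
        using card_chain_less_if_Inter_not_bottom[OF fin ch sub ne] by blast
      moreover have "card ?K = card ?R + (card ?M - 1)"
        using finLR finite_hits hit PQ by (subst card_Un_disjoint) auto
      moreover have "0 < card ?M" using finite_hits hit PQ by (auto simp: card_gt_0_iff)
      ultimately show ?thesis by linarith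
    qed
    ultimately show ?thesis by linarith
  qed
  have "(\<Sum>xs\<in>?G. 2 * real (card (hits F xs)) + real (card ?L) + real (card ?R)) \<le>
      (\<Sum>xs\<in>?G. 2 * real k + 2 * real (card {X\<in>?L. X \<in> hits F xs}) + 2 * real (card {X\<in>?R. X \<in> hits F xs}))"
    using of_nat_mono[OF pointwise, where 'a = real] by (intro sum_mono) simp
  also have "\<dots> = 2 * real k * real (card ?G) + (\<Sum>X\<in>?L. 2 * real (card {xs \<in> ?G. X \<in> hits F xs}))
      + (\<Sum>X\<in>?R. 2 * real (card {xs \<in> ?G. X \<in> hits F xs}))"
    using sum_card_over_hits[OF finG finLR(1)] sum_card_over_hits[OF finG finLR(2)]
    by (simp add: sum.distrib flip: sum_distrib_left)
  also have "\<dots> \<le> 2 * real k * real (card ?G) + (\<Sum>X\<in>?L. real (card ?G)) + (\<Sum>X\<in>?R. real (card ?G))"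
    using of_nat_mono[OF half, where 'a = real] of_nat_mono[OF half', where 'a = real]
    by (intro add_mono sum_mono order_refl) simp_all
  finally show ?thesis
    by (simp add: sum.distrib algebra_simps flip: sum_distrib_left)
qed simp

text \<open>A singleton below another member may be hit with conditional probability one half, which for
  \<open>k = 2\<close> is more than \<open>lowest_class_sum\<close> can afford. The weight one half halves this share. It is
  harmless for the size of the family only if the second largest level has at least \<open>2 * n\<close> sets, which is
  where \<open>n \<ge> 5\<close> comes from.\<close>

definition weight :: "nat set \<Rightarrow> real" where
  "weight X = (if k = 2 \<and> 5 \<le> n \<and> card X = 1 then 1 / 2 else 1)"

lemma weight_le_1: "weight X \<le> 1"
  by (simp add: weight_def)

text \<open>Let \<open>A\<close> be the lowest hit that is both a top and a bottom. The hits below \<open>A\<close> lie in a chain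
  of fewer than \<open>k\<close> members and have probability at most one half each; the hits above \<open>A\<close> contribute
  at most \<open>2 / 3\<close>. For \<open>k \<ge> 3\<close> this gives \<open>(k - 1) / 2 + 1 + 2 / 3 \<le> k\<close>. For \<open>k = 2\<close> the single
  member below \<open>A\<close> must contribute at most \<open>1 / 3\<close>. A singleton does so by its weight; a larger set has
  no member of the family below it, so its hitting probability is at most one third. If \<open>n \<le> 4\<close>, there is so little
  room above \<open>A\<close> that its share drops to \<open>1 / 2\<close>.\<close>

lemma lowest_class_sum:
  "(\<Sum>xs\<in>lowest_class {1..n} F (U \<inter> D) A. \<Sum>X\<in>hits F xs. weight X)
    \<le> real k * real (card (lowest_class {1..n} F (U \<inter> D) A))"
proof (cases "lowest_class {1..n} F (U \<inter> D) A = {}")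
  case False
  let ?G = "lowest_class {1..n} F (U \<inter> D) A"
  let ?L = "{X \<in> F. X \<subset> A \<and> X \<notin> U}"
  note GD = lowest_classD[OF finite_F, of _ "{1..n}" "U \<inter> D" A]
  have G: "?G \<subseteq> orders" using GD(1) by blast
  then have finG: "finite ?G" using finite_permutations_of_set finite_subset by blast
  obtain xs0 where xs0: "xs0 \<in> ?G" using False by blast
  have A: "A \<in> U" "A \<in> D" "A \<in> F" using GD(2)[OF xs0] tops_subset by auto
  have Bchain: "chain_subset {X \<in> F. X \<subset> A}" by (rule below_chain[OF A(2)])
  then have Lchain: "chain_subset ?L" by (rule chain_subset_mono) auto
  have finL: "finite ?L" using finite_F by simp
  have cardL: "card ?L < k"
  proof (cases "?L = {}")
    case True
    then have "card ?L = 0" by (simp only: card.empty)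
    then show ?thesis using k by linarith
  next
    case ne: False
    have "\<Union>?L \<in> ?L" by (rule chain_Union_mem[OF finL ne Lchain])
    then show ?thesis
      using card_chain_less_if_Union_not_top[OF finL Lchain _ ne, of F k] by blast
  qed
  have stable: "ys \<in> ?G"
    if xs: "xs \<in> ?G" and ys: "ys \<in> orders" "hits F ys = hits F xs - {X}" and X: "X \<in> ?L" for xs ys X
    by (rule lowest_classI[OF ys(1)]) (use GD[OF xs] ys(2) X in auto)
  have larger: "card X < card A" if "X \<in> F" "X \<subset> A" for X
    using card_less that A by blast
  have strict: "W \<subset> A" if "W \<in> F" "card W \<le> card X" "W \<subseteq> A \<or> A \<subseteq> W" "X \<in> F" "X \<subset> A" for W X
    using that larger[of X] card_mono[of W A] member(1)[of W]
    by (metis (no_types, lifting) leD le_trans order_le_less psubsetI)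
  have half: "2 * card {xs \<in> ?G. X \<in> hits F xs} \<le> card ?G" if X: "X \<in> ?L" for X
  proof (rule two_card_hit_le[where V = "{1..n}" and C = A])
    show "card A \<noteq> card X" using larger[of X] X by auto
    fix W assume W: "W \<in> F" "card W = card X" "W \<subseteq> A \<or> A \<subseteq> W"
    then show "W = X" using same_card_eq[OF Bchain, of W X] strict[of W X] X by auto
  qed (use X G member GD(3) stable in auto)
  define c where "c = real (card ?G)"
  have c: "0 \<le> c" by (simp add: c_def)
  define low where "low = (\<Sum>X\<in>?L. weight X * real (card {xs \<in> ?G. X \<in> hits F xs}))"
  have half_real: "real (card {xs \<in> ?G. X \<in> hits F xs}) \<le> c / 2" if "X \<in> ?L" for X
    using of_nat_mono[OF half[OF that], where 'a = real] by (simp add: c_def)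
  have low_half: "low \<le> real (k - 1) * (c / 2)"
  proof -
    have "low \<le> (\<Sum>X\<in>?L. c / 2)"
      unfolding low_def
    proof (rule sum_mono)
      fix X assume "X \<in> ?L"
      then have "real (card {xs \<in> ?G. X \<in> hits F xs}) \<le> c / 2" by (rule half_real)
      then have "weight X * real (card {xs \<in> ?G. X \<in> hits F xs}) \<le> 1 * (c / 2)"
        using weight_le_1 by (intro mult_mono) auto
      then show "weight X * real (card {xs \<in> ?G. X \<in> hits F xs}) \<le> c / 2" by simp
    qed
    also have "\<dots> = real (card ?L) * (c / 2)" by simp
    also have "\<dots> \<le> real (k - 1) * (c / 2)" using cardL c by (intro mult_right_mono) auto
    finally show ?thesis .
  qed
  have low_third: "low \<le> c / 3" if k2: "k = 2" "5 \<le> n"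
  proof (cases "?L = {}")
    case True
    then have "low = 0" unfolding low_def by (simp only: sum.empty)
    then show ?thesis using c by simp
  next
    case False
    moreover have "card ?L = 1" using cardL k2 finL False card_gt_0_iff[of ?L] by linarith
    then obtain X where L: "?L = {X}" by (auto simp: card_1_singleton_iff)
    then have X: "X \<in> ?L" by blast
    have low_eq: "low = weight X * real (card {xs \<in> ?G. X \<in> hits F xs})"
      unfolding low_def L by simp
    show ?thesis
    proof (cases "card X = 1")
      case True
      then have "weight X = 1 / 2" unfolding weight_def using k2 by simp
      then have "low = 1 / 2 * real (card {xs \<in> ?G. X \<in> hits F xs})" by (simp only: low_eq)
      then show ?thesis using half_real[OF X] c by linarith
    next
      case False
      have XD: "X \<notin> U" using X by blast
      \<comment> \<open>A second member below X would make X a top.\<close>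
      have nothing_below: "\<not> W \<subset> X" if "W \<in> F" for W
      proof
        assume "W \<subset> X"
        then have "X \<in> U"
          using that X k2 unfolding tops_def chain_subset_def
          by (intro CollectI conjI exI[of _ "{W, X}"]) auto
        with XD show False ..
      qed
      have "3 * card {xs \<in> ?G. X \<in> hits F xs} \<le> card ?G"
      proof (rule three_card_hit_le[where V = "{1..n}" and C = A])
        show "2 \<le> card X" using False member(2)[of X] X by auto
        show "card X < card A" using larger X by auto
        fix W assume W: "W \<in> F" "card W \<le> card X" "W \<subseteq> A"
        then have "W \<subset> A" using strict X by blast
        then have "W \<subseteq> X \<or> X \<subseteq> W"
          using Bchain W(1) X unfolding chain_subset_def by blast
        then show "W = X"
          using nothing_below[OF W(1)] card_less[of X W] W X by (metis (no_types, lifting) leD mem_Collect_eq psubsetI)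
      qed (use X G member GD(3) stable in auto)
      from of_nat_mono[OF this, where 'a = real]
      have "3 * real (card {xs \<in> ?G. X \<in> hits F xs}) \<le> c" by (simp add: c_def)
      moreover have "weight X = 1" unfolding weight_def using False by simp
      then have "low = 1 * real (card {xs \<in> ?G. X \<in> hits F xs})" by (simp only: low_eq)
      ultimately show ?thesis by linarith
    qed
  qed
  let ?d = "n - card A"
  have above: "(\<Sum>xs\<in>?G. real (card {X \<in> hits F xs. A \<subset> X})) \<le> inverse_binomial_sum ?d * c"
    using sum_hits_above_le[OF _ sets proper(2) above_chain[OF A(1)] refl, of "U \<inter> D"] by (simp add: c_def)
  have pointwise: "(\<Sum>X\<in>hits F xs. weight X) \<le>
      (\<Sum>X\<in>{X\<in>?L. X \<in> hits F xs}. weight X) + 1 + real (card {X \<in> hits F xs. A \<subset> X})"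
    if xs: "xs \<in> ?G" for xs
  proof -
    let ?h = "hits F xs"
    have eq: "?h = {X\<in>?L. X \<in> ?h} \<union> ({A} \<union> {X \<in> ?h. A \<subset> X})"
    proof -
      have "X \<in> {X\<in>?L. X \<in> ?h} \<union> ({A} \<union> {X \<in> ?h. A \<subset> X})" if X: "X \<in> ?h" for X
      proof -
        have "X \<subseteq> A \<or> A \<subseteq> X"
          using hits_chain[of F xs] X GD(3)[OF xs] unfolding chain_subset_def by blast
        moreover have "X \<notin> U" if "X \<subset> A"
          using GD(4)[OF xs, of X] bottoms_downward[OF A(2), of X] that X hitsD(1)[OF X] by blast
        ultimately show ?thesis using X hitsD(1)[OF X] by blast
      qed
      then show ?thesis using GD(3)[OF xs] by blast
    qed
    have "(\<Sum>X\<in>?h. weight X) = (\<Sum>X\<in>{X\<in>?L. X \<in> ?h} \<union> ({A} \<union> {X \<in> ?h. A \<subset> X}). weight X)"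
      using eq by (rule arg_cong)
    also have "\<dots> = (\<Sum>X\<in>{X\<in>?L. X \<in> ?h}. weight X) + (weight A + (\<Sum>X\<in>{X \<in> ?h. A \<subset> X}. weight X))"
      using finL finite_hits by (subst sum.union_disjoint; (subst sum.union_disjoint)?) auto
    also have "(\<Sum>X\<in>{X \<in> ?h. A \<subset> X}. weight X) \<le> (\<Sum>X\<in>{X \<in> ?h. A \<subset> X}. 1)"
      using weight_le_1 by (intro sum_mono)
    finally show ?thesis using weight_le_1[of A] by simp
  qed
  have "(\<Sum>xs\<in>?G. \<Sum>X\<in>hits F xs. weight X) \<le>
      (\<Sum>xs\<in>?G. (\<Sum>X\<in>{X\<in>?L. X \<in> hits F xs}. weight X) + 1 + real (card {X \<in> hits F xs. A \<subset> X}))"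
    using pointwise by (intro sum_mono)
  also have "\<dots> = low + c + (\<Sum>xs\<in>?G. real (card {X \<in> hits F xs. A \<subset> X}))"
    using sum_over_hits[OF finG finL, where F = F and w = weight] by (simp add: sum.distrib low_def c_def)
  also have "\<dots> \<le> low + c + inverse_binomial_sum ?d * c"
    using above by simp
  also have "\<dots> \<le> real k * c"
  proof -
    have thirds: "inverse_binomial_sum ?d * c \<le> 2 / 3 * c"
      using c inverse_binomial_sum_le_two_thirds by (intro mult_right_mono)
    consider "3 \<le> k" | "k = 2" "5 \<le> n" | "k = 2" "n \<le> 4" using k by linarith
    then show ?thesis
    proof cases
      case 1
      have "real (k - 1) = real k - 1" using k by (simp add: of_nat_diff)
      with low_half have "low \<le> real k * c / 2 - c / 2" by (simp add: algebra_simps)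
      moreover have "3 * c \<le> real k * c" using 1 c by (intro mult_right_mono) auto
      ultimately show ?thesis using thirds c by linarith
    next
      case 2
      then show ?thesis using low_third thirds by simp
    next
      case 3
      \<comment> \<open>As a top, A contains a smaller nonempty member.\<close>
      have "2 \<le> card A"
      proof -
        obtain K where K: "K \<subseteq> F" "finite K" "2 \<le> card K" "A \<in> K" "\<forall>X\<in>K. X \<subseteq> A"
          using A(1) 3 unfolding tops_def by blast
        then obtain X where "X \<in> K" "X \<noteq> A"
          by (metis card_le_Suc0_iff_eq not_less_eq_eq numeral_2_eq_2)
        then show ?thesis using K larger[of X] member(2)[of X] by fastforce
      qed
      moreover have "card A < n" using member(3)[OF A(3)] by simp
      ultimately have d: "?d \<in> {1, 2}" using 3 by auto
      then have "inverse_binomial_sum ?d \<le> 1 - 1 / real ?d"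
        by (intro inverse_binomial_sum_le) auto
      also have "\<dots> \<le> 1 / 2" using d by auto
      finally have "inverse_binomial_sum ?d * c \<le> 1 / 2 * c"
        using c by (intro mult_right_mono)
      then show ?thesis using low_half 3 by simp
    qed
  qed
  finally show ?thesis by (simp add: c_def)
qed simp

text \<open>The three kinds of maximal chains together: those that meet a member which is both top and
  bottom, those that meet tops and bottoms separately, and those that miss one of the two.\<close>

lemma weighted_hits_le:
  "(\<Sum>xs\<in>orders. \<Sum>X\<in>hits F xs. weight X) \<le> real k * fact n"
proof -
  let ?g = "\<lambda>xs. \<Sum>X\<in>hits F xs. weight X"
  let ?S1 = "{xs \<in> orders. U \<inter> D \<inter> hits F xs \<noteq> {}}"
  let ?S2 = "{xs \<in> orders. U \<inter> D \<inter> hits F xs = {} \<and> D \<inter> hits F xs \<noteq> {} \<and> U \<inter> hits F xs \<noteq> {}}"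
  let ?S3 = "{xs \<in> orders. U \<inter> hits F xs = {} \<or> D \<inter> hits F xs = {}}"
  have g: "?g xs \<le> real (card (hits F xs))" for xs
    using sum_mono[of "hits F xs" weight "\<lambda>_. 1"] weight_le_1 by simp
  have 1: "sum ?g ?S1 \<le> real k * real (card ?S1)"
  proof (rule sum_le_fibrewise)
    fix A
    have "{xs \<in> ?S1. \<Inter>(U \<inter> D \<inter> hits F xs) = A} = lowest_class {1..n} F (U \<inter> D) A"
      by (auto simp: lowest_class_def)
    then show "sum ?g {xs \<in> ?S1. \<Inter>(U \<inter> D \<inter> hits F xs) = A} \<le>
        real k * real (card {xs \<in> ?S1. \<Inter>(U \<inter> D \<inter> hits F xs) = A})"
      using lowest_class_sum[of A] by simp
  qed simp
  have 2: "sum ?g ?S2 \<le> real k * real (card ?S2)"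
  proof (rule sum_le_fibrewise)
    fix PQ :: "nat set \<times> nat set"
    let ?f = "\<lambda>xs. (\<Union>(D \<inter> hits F xs), \<Inter>(U \<inter> hits F xs))"
    have eq: "{xs \<in> ?S2. ?f xs = PQ} = middle_class (fst PQ) (snd PQ)"
      by (auto simp: middle_class_def)
    have "sum ?g (middle_class (fst PQ) (snd PQ)) \<le>
        (\<Sum>xs\<in>middle_class (fst PQ) (snd PQ). real (card (hits F xs)))"
      using g by (intro sum_mono)
    then show "sum ?g {xs \<in> ?S2. ?f xs = PQ} \<le> real k * real (card {xs \<in> ?S2. ?f xs = PQ})"
      unfolding eq using middle_class_sum by (rule order_trans)
  qed simp
  have 3: "sum ?g ?S3 \<le> real k * real (card ?S3)"
  proof -
    have "?g xs \<le> real k" if "xs \<in> ?S3" for xs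
    proof -
      have "card (hits F xs) < k" using that few_hits by blast
      then show ?thesis using g[of xs] by linarith
    qed
    then have "sum ?g ?S3 \<le> (\<Sum>xs\<in>?S3. real k)" by (intro sum_mono)
    then show ?thesis by (simp add: mult.commute)
  qed
  have split: "orders = ?S1 \<union> (?S2 \<union> ?S3)" by auto
  have sum_split: "sum f orders = sum f ?S1 + (sum f ?S2 + sum f ?S3)" for f :: "nat list \<Rightarrow> real"
    by (subst split, (subst sum.union_disjoint; (subst sum.union_disjoint)?)) auto
  have "real k * fact n = real k * real (card orders)" by simp
  also have "real (card orders) = real (card ?S1) + (real (card ?S2) + real (card ?S3))"
    using sum_split[of "\<lambda>_. 1"] by simp
  finally show ?thesis
    using 1 2 3 sum_split[of ?g] by (simp add: algebra_simps)
qed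

end

section \<open>From averages over chains to the size of the family\<close>

lemma sum_hits_total:
  fixes w :: "'a set \<Rightarrow> real"
  assumes V: "finite V" and F: "F \<subseteq> Pow V"
  shows "(\<Sum>xs\<in>permutations_of_set V. \<Sum>A\<in>hits F xs. w A) =
    fact (card V) * (\<Sum>A\<in>F. w A / real (card V choose card A))"
proof -
  have finF: "finite F" using V F finite_subset by blast
  have each: "real (card {xs \<in> permutations_of_set V. A \<in> hits F xs}) = fact (card V) / real (card V choose card A)"
    if A: "A \<in> F" for A
  proof -
    have AV: "A \<subseteq> V" using A F by blast
    have "{xs \<in> permutations_of_set V. A \<in> hits F xs} = {xs \<in> permutations_of_set V. set (take (card A) xs) = A}"
      using A by (simp add: hits_def)
    moreover have "0 < card V choose card A"
      using card_mono[OF V AV] by simp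
    ultimately show ?thesis
      using arg_cong[OF card_hitting[OF V AV], of real] by (simp add: field_simps)
  qed
  have "(\<Sum>xs\<in>permutations_of_set V. \<Sum>A\<in>hits F xs. w A) =
      (\<Sum>xs\<in>permutations_of_set V. \<Sum>A\<in>{A\<in>F. A \<in> hits F xs}. w A)"
    by (intro sum.cong refl) (auto simp: hits_def)
  also have "\<dots> = (\<Sum>A\<in>F. w A * real (card {xs \<in> permutations_of_set V. A \<in> hits F xs}))"
    by (rule sum_over_hits[OF finite_permutations_of_set finF])
  also have "\<dots> = (\<Sum>A\<in>F. fact (card V) * (w A / real (card V choose card A)))"
    using each by (intro sum.cong) auto
  finally show ?thesis by (simp add: sum_distrib_left)
qed

text \<open>The number \<^term>\<open>M\<close> separates the sizes of the chosen levels from those of the others. Every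
  member of \<^term>\<open>F\<close> pays \<open>M\<close> times its weighted share in the sum; the unpaid rest of its cost 1 is at
  most \<open>1 - M / (n choose i)\<close> on a chosen level \<open>i\<close> and at most zero on the other levels.\<close>

lemma card_le_of_weighted_sum:
  fixes M c :: real
  assumes F: "F \<subseteq> Pow {1..n}" and L: "L \<subseteq> {0..n}" and M: "0 < M"
    and inL: "\<And>i. i \<in> L \<Longrightarrow> M \<le> real (n choose i)"
    and notL: "\<And>i. i \<in> {0..n} - L \<Longrightarrow> real (n choose i) \<le> M"
    and w: "\<And>A. A \<in> F \<Longrightarrow> w A = 1 \<or> real (n choose card A) \<le> M * w A"
    and le: "(\<Sum>A\<in>F. w A / real (n choose card A)) \<le> c"
  shows "real (card F) \<le> (\<Sum>i\<in>L. real (n choose i)) - (real (card L) - c) * M"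
proof -
  let ?b = "\<lambda>A. real (n choose card A)"
  have finF: "finite F" using F finite_subset by blast
  have finL: "finite L" using L finite_subset by blast
  let ?P = "\<Union>i\<in>L. level n i"
  have finlev: "finite (level n i)" for i
    by (rule finite_subset[of _ "Pow {1..n}"]) (auto simp: level_def)
  have gain: "1 - M * (w A / ?b A) \<le> (if card A \<in> L then 1 - M / ?b A else 0)" if A: "A \<in> F" for A
  proof -
    have le_n: "card A \<le> n" using A F card_mono[of "{1..n}" A] by auto
    then have b: "0 < ?b A" by simp
    from w[OF A] show ?thesis
    proof
      assume "w A = 1"
      then show ?thesis using notL[of "card A"] b le_n by (auto simp: field_simps)
    next
      assume "?b A \<le> M * w A"
      then have "1 - M * (w A / ?b A) \<le> 0" using b by (simp add: field_simps)
      moreover have "0 \<le> (if card A \<in> L then 1 - M / ?b A else 0)"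
        using inL[of "card A"] b by (auto simp: field_simps)
      ultimately show ?thesis by linarith
    qed
  qed
  have "real (card F) = M * (\<Sum>A\<in>F. w A / ?b A) + (\<Sum>A\<in>F. 1 - M * (w A / ?b A))"
    by (simp add: sum_subtractf sum_distrib_left)
  also have "\<dots> \<le> M * c + (\<Sum>A\<in>F. if card A \<in> L then 1 - M / ?b A else 0)"
    using le M gain by (intro add_mono sum_mono mult_left_mono) auto
  also have "(\<Sum>A\<in>F. if card A \<in> L then 1 - M / ?b A else 0) = (\<Sum>A\<in>{A\<in>F. card A \<in> L}. 1 - M / ?b A)"
    using finF by (simp add: sum.inter_filter)
  also have "\<dots> \<le> (\<Sum>A\<in>?P. 1 - M / ?b A)"
  proof (rule sum_mono2)
    show "finite ?P" using finL finlev by blast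
    show "{A \<in> F. card A \<in> L} \<subseteq> ?P" using F by (auto simp: level_def)
    fix A assume "A \<in> ?P - {A \<in> F. card A \<in> L}"
    then have "card A \<in> L" by (auto simp: level_def)
    then have "M \<le> ?b A" by (rule inL)
    moreover have "0 < ?b A" using M calculation by linarith
    ultimately show "0 \<le> 1 - M / ?b A" by simp
  qed
  also have "\<dots> = (\<Sum>i\<in>L. \<Sum>A\<in>level n i. 1 - M / ?b A)"
    using finL finlev by (intro sum.UNION_disjoint) (auto simp: level_def)
  also have "\<dots> = (\<Sum>i\<in>L. real (n choose i) - M)"
  proof (rule sum.cong[OF refl])
    fix i assume i: "i \<in> L"
    have "(\<Sum>A\<in>level n i. 1 - M / ?b A) = (\<Sum>A\<in>level n i. 1 - M / real (n choose i))"
      by (intro sum.cong) (auto simp: level_def)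
    also have "\<dots> = real (n choose i) * (1 - M / real (n choose i))" by (simp add: card_level)
    also have "\<dots> = real (n choose i) - M" using i L by (auto simp: right_diff_distrib)
    finally show "(\<Sum>A\<in>level n i. 1 - M / ?b A) = real (n choose i) - M" .
  qed
  finally show ?thesis by (simp add: sum_subtractf algebra_simps)
qed

section \<open>The largest levels\<close>

text \<open>Turning the sorted list of level sizes into a set \<^term>\<open>L\<close> of levels, with the level \<^term>\<open>l\<close> in the
  last selected position as the threshold.\<close>

lemma largest_levels:
  assumes "1 \<le> k" "k \<le> n + 1"
  obtains L l where "L \<subseteq> {0..n}" "card L = k" "(\<Sum>i\<in>L. n choose i) = Sigma_levels n k"
    "l \<in> L" "\<And>i. i \<in> L \<Longrightarrow> n choose l \<le> n choose i" "\<And>i. i \<in> {0..n} - L \<Longrightarrow> n choose i \<le> n choose l"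
proof -
  let ?f = "\<lambda>i. n choose i"
  define js where "js = rev (sort_key ?f [0..<n + 1])"
  have js: "distinct js" "set js = {0..n}" "length js = n + 1"
    by (auto simp: js_def)
  have sorted: "?f (js ! j) \<le> ?f (js ! i)" if "i \<le> j" "j < n + 1" for i j
  proof -
    have "sorted (rev (map ?f js))" by (simp add: js_def flip: rev_map)
    then show ?thesis using sorted_rev_nth_mono[of "map ?f js" i j] that js(3) by simp
  qed
  have "sort (map ?f [0..<n + 1]) = map ?f (sort_key ?f [0..<n + 1])"
    by (rule properties_for_sort) (simp_all del: upt_Suc)
  then have "rev (sort (map (\<lambda>i. card (level n i)) [0..<n + 1])) = map ?f js"
    by (simp add: card_level js_def rev_map del: upt_Suc)
  then have "Sigma_levels n k = sum_list (map ?f (take k js))"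
    by (simp add: Sigma_levels_def take_map)
  also have "\<dots> = (\<Sum>i\<in>set (take k js). ?f i)"
    using js(1) by (simp add: sum_list_distinct_conv_sum_set)
  finally have sum: "(\<Sum>i\<in>set (take k js). ?f i) = Sigma_levels n k" by simp
  show thesis
  proof (rule that[of "set (take k js)" "js ! (k - 1)"])
    show "set (take k js) \<subseteq> {0..n}" using js(2) set_take_subset by metis
    show "card (set (take k js)) = k" using js assms by (simp add: distinct_card)
    show "(\<Sum>i\<in>set (take k js). ?f i) = Sigma_levels n k" by (rule sum)
    show "js ! (k - 1) \<in> set (take k js)"
      using js(3) assms by (auto simp: in_set_conv_nth intro!: exI[of _ "k - 1"])
    fix i
    show "?f (js ! (k - 1)) \<le> ?f i" if "i \<in> set (take k js)"
      using that js(3) assms by (auto simp: in_set_conv_nth intro!: sorted)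
    show "?f i \<le> ?f (js ! (k - 1))" if i: "i \<in> {0..n} - set (take k js)"
    proof -
      have "i \<in> set js" using i js(2) by blast
      then obtain m where m: "m < n + 1" "i = js ! m"
        unfolding in_set_conv_nth js(3) by blast
      have "\<not> m < k"
      proof
        assume "m < k"
        then have "i \<in> set (take k js)"
          using m js(3) by (auto simp: in_set_conv_nth intro!: exI[of _ m])
        then show False using i by blast
      qed
      then show ?thesis using m sorted[of "k - 1" m] by simp
    qed
  qed
qed

text \<open>There are \<open>n - 2 * a + 1\<close> levels from \<open>a\<close> to \<open>n - a\<close>, all at least as large as level \<open>a\<close>. A smaller
  threshold would put all of them into \<^term>\<open>L\<close>, and the threshold level in addition.\<close>

lemma kth_largest_level_ge:
  assumes L: "L \<subseteq> {0..n}" "card L \<le> n - 2 * a + 1" "l \<in> L" and a: "2 * a \<le> n"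
    and out: "\<And>i. i \<in> {0..n} - L \<Longrightarrow> n choose i \<le> n choose l"
  shows "n choose a \<le> n choose l"
proof (rule ccontr)
  assume small: "\<not> n choose a \<le> n choose l"
  have "{a..n - a} \<subseteq> L"
  proof
    fix i assume i: "i \<in> {a..n - a}"
    then have "n choose a \<le> n choose i" using a by (intro binomial_ge_inner) auto
    then show "i \<in> L" using out[of i] small i by fastforce
  qed
  moreover have "l \<notin> {a..n - a}"
    using small binomial_ge_inner[of a l n] a by fastforce
  ultimately have "card (insert l {a..n - a}) \<le> card L"
    using L finite_subset[OF L(1)] by (intro card_mono) auto
  moreover have "card (insert l {a..n - a}) = n - 2 * a + 2"
    using \<open>l \<notin> {a..n - a}\<close> a by simp
  ultimately show False using L(2) by simp
qed

section \<open>Families containing an extreme set\<close>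

text \<open>Below the lowest hit among the tops a maximal chain has fewer than \<^term>\<open>j\<close> hits, and above it
  the average is below one by a margin of \<open>1 / (n - 1)\<close>.\<close>

lemma hits_sum_with_one_spare:
  assumes j: "1 \<le> j" and n: "2 \<le> n" and F: "F \<subseteq> Pow {1..n}" "{} \<notin> F" "{1..n} \<notin> F"
    and above: "\<And>A. A \<in> tops j F \<Longrightarrow> chain_subset {B \<in> F. A \<subset> B}"
  shows "(\<Sum>A\<in>F. 1 / real (n choose card A)) \<le> real j + 1 - 1 / (real n - 1)"
proof -
  let ?c = "real j + 1 - 1 / (real n - 1)"
  let ?U = "tops j F"
  let ?g = "\<lambda>xs. real (card (hits F xs))"
  let ?\<Omega> = "permutations_of_set {1..n}"
  let ?S1 = "{xs \<in> ?\<Omega>. ?U \<inter> hits F xs \<noteq> {}}" and ?S2 = "{xs \<in> ?\<Omega>. ?U \<inter> hits F xs = {}}"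
  have finF: "finite F" using F finite_subset by blast
  have finh: "finite (hits F xs)" for xs using finF finite_subset[OF hits_subset] by blast
  have few: "card K < j" if K: "K \<subseteq> hits F xs" "?U \<inter> K = {}" for K xs
  proof (cases "K = {}")
    case False
    have K': "finite K" "chain_subset K" "K \<subseteq> F"
      using finite_subset[OF K(1) finh] chain_subset_mono[OF hits_chain K(1)]
        order_trans[OF K(1) hits_subset] by simp_all
    then show ?thesis
      using card_chain_less_if_Union_not_top[OF K' False] chain_Union_mem[OF K'(1) False K'(2)] K(2) by blast
  qed (use j in simp)
  have c: "real j \<le> ?c" using n by (simp add: field_simps)
  have 1: "sum ?g ?S1 \<le> ?c * real (card ?S1)"
  proof (rule sum_le_fibrewise)
    fix A
    let ?G = "lowest_class {1..n} F ?U A"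
    have eq: "{xs \<in> ?S1. \<Inter>(?U \<inter> hits F xs) = A} = ?G"
      by (auto simp: lowest_class_def)
    have "sum ?g ?G \<le> ?c * real (card ?G)"
    proof (cases "?G = {}")
      case False
      note GD = lowest_classD[OF finF, of _ "{1..n}" ?U A]
      obtain xs0 where "xs0 \<in> ?G" using False by blast
      then have A: "A \<in> ?U" "A \<in> F" using GD(2,3) hitsD(1) by blast+
      have cA: "1 \<le> card A" "card A < n"
      proof -
        have "A \<subset> {1..n}" using A F by blast
        then show "card A < n" using psubset_card_mono[of "{1..n}" A] by simp
        have "finite A" using A F finite_subset by blast
        moreover have "A \<noteq> {}" using A F by blast
        ultimately show "1 \<le> card A" by (simp add: Suc_le_eq card_gt_0_iff)
      qed
      have pointwise: "?g xs \<le> real j + real (card {X \<in> hits F xs. A \<subset> X})" if xs: "xs \<in> ?G" for xs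
      proof -
        let ?h = "hits F xs"
        have "X \<subseteq> A \<or> A \<subseteq> X" if "X \<in> ?h" for X
          using hits_chain[of F xs] that GD(3)[OF xs] unfolding chain_subset_def by blast
        then have eq: "?h = {X\<in>?h. X \<subset> A} \<union> ({A} \<union> {X \<in> ?h. A \<subset> X})"
          using GD(3)[OF xs] by blast
        have "card ?h = card ({X\<in>?h. X \<subset> A} \<union> ({A} \<union> {X \<in> ?h. A \<subset> X}))"
          using eq by (rule arg_cong)
        also have "\<dots> \<le> card {X\<in>?h. X \<subset> A} + card ({A} \<union> {X \<in> ?h. A \<subset> X})"
          by (rule card_Un_le)
        also have "\<dots> \<le> card {X\<in>?h. X \<subset> A} + (card {A} + card {X \<in> ?h. A \<subset> X})"
          by (intro add_left_mono card_Un_le)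
        finally have "card ?h \<le> card {X\<in>?h. X \<subset> A} + (1 + card {X \<in> ?h. A \<subset> X})" by simp
        moreover have "card {X\<in>?h. X \<subset> A} < j"
          using GD(4)[OF xs] by (intro few) blast+
        ultimately show ?thesis by linarith
      qed
      let ?d = "n - card A"
      have "sum ?g ?G \<le> (\<Sum>xs\<in>?G. real j + real (card {X \<in> hits F xs. A \<subset> X}))"
        using pointwise by (intro sum_mono)
      also have "\<dots> = real j * real (card ?G) + (\<Sum>xs\<in>?G. real (card {X \<in> hits F xs. A \<subset> X}))"
        by (simp add: sum.distrib)
      also have "\<dots> \<le> real j * real (card ?G) + inverse_binomial_sum ?d * real (card ?G)"
        using sum_hits_above_le[OF _ F(1,3) above[OF A(1)] refl, of ?U] by simp
      also have "\<dots> \<le> real j * real (card ?G) + (1 - 1 / (real n - 1)) * real (card ?G)"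
      proof -
        have "inverse_binomial_sum ?d \<le> 1 - 1 / real ?d"
          using cA by (intro inverse_binomial_sum_le) auto
        also have "\<dots> \<le> 1 - 1 / (real n - 1)"
        proof -
          have "1 / (real n - 1) \<le> 1 / real ?d"
            using cA by (intro frac_le) (auto simp: of_nat_diff)
          then show ?thesis by simp
        qed
        finally show ?thesis by (intro add_left_mono mult_right_mono) auto
      qed
      finally show ?thesis by (simp add: algebra_simps)
    qed simp
    then show "sum ?g {xs \<in> ?S1. \<Inter>(?U \<inter> hits F xs) = A} \<le>
        ?c * real (card {xs \<in> ?S1. \<Inter>(?U \<inter> hits F xs) = A})"
      unfolding eq .
  qed simp
  have 2: "sum ?g ?S2 \<le> ?c * real (card ?S2)"
  proof -
    have "?g xs \<le> ?c" if "xs \<in> ?S2" for xs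
    proof -
      have "card (hits F xs) < j" using that by (intro few) auto
      then show ?thesis using c by linarith
    qed
    then have "sum ?g ?S2 \<le> (\<Sum>xs\<in>?S2. ?c)" by (intro sum_mono)
    then show ?thesis by (simp add: mult.commute)
  qed
  have split: "?\<Omega> = ?S1 \<union> ?S2" by auto
  have sum_split: "sum f ?\<Omega> = sum f ?S1 + sum f ?S2" for f :: "nat list \<Rightarrow> real"
    by (subst split, subst sum.union_disjoint) auto
  have "fact n * (\<Sum>A\<in>F. 1 / real (n choose card A)) = sum ?g ?\<Omega>"
    using sum_hits_total[OF _ F(1), of "\<lambda>_. 1"] by simp
  also have "\<dots> \<le> ?c * (real (card ?S1) + real (card ?S2))"
    using 1 2 sum_split[of ?g] by (simp only: distrib_left)
  also have "real (card ?S1) + real (card ?S2) = fact n"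
    using sum_split[of "\<lambda>_. 1"] by simp
  finally show ?thesis by (simp add: mult.commute)
qed

text \<open>The empty set prolongs every chain downwards, so the rest of the family may be treated with
  \<open>k - 1\<close> in place of \<open>k\<close>. The spare \<open>1 / (n - 1)\<close>, multiplied by a level size of at least \<open>n\<close>, exceeds
  one; by integrality this leaves room for both the empty set and the full set.\<close>

lemma card_le_if_empty_mem:
  assumes k: "2 \<le> k" and n: "k + 1 \<le> n" and F: "F \<subseteq> Pow {1..n}" "{} \<in> F"
    and free: "induced_free (Y_poset k) F"
  shows "card F \<le> Sigma_levels n k"
proof -
  define F0 where "F0 = F - {{}, {1..n}}"
  have F0: "F0 \<subseteq> Pow {1..n}" "{} \<notin> F0" "{1..n} \<notin> F0" "F0 \<subseteq> F" using F by (auto simp: F0_def)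
  have finF: "finite F" using F finite_subset by blast
  have "chain_subset {B \<in> F0. A \<subset> B}" if A: "A \<in> tops (k - 1) F0" for A
  proof -
    obtain K where K: "A \<in> F0" "K \<subseteq> F0" "finite K" "chain_subset K" "k - 1 \<le> card K" "A \<in> K"
        "\<forall>X\<in>K. X \<subseteq> A"
      using A unfolding tops_def by blast
    have "{} \<notin> K" using K(2) F0(2) by blast
    then have "k \<le> card (insert {} K)" using K(3,5) by simp
    moreover have "chain_subset (insert {} K)"
      using K(4) unfolding chain_subset_def by blast
    ultimately have "A \<in> tops k F"
      using K F0(4) F(2) unfolding tops_def
      by (intro CollectI conjI exI[of _ "insert {} K"]) auto
    then have "chain_subset {B \<in> F. A \<subset> B}"
      using chain_above_top[OF _ free] k by simp
    then show ?thesis by (rule chain_subset_mono) (use F0(4) in blast)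
  qed
  then have lym: "(\<Sum>A\<in>F0. 1 / real (n choose card A)) \<le> real k - 1 / (real n - 1)"
    using hits_sum_with_one_spare[of "k - 1" n F0] k n F0 by (simp add: of_nat_diff)
  obtain L l where L: "L \<subseteq> {0..n}" "card L = k" "(\<Sum>i\<in>L. n choose i) = Sigma_levels n k"
    "l \<in> L" "\<And>i. i \<in> L \<Longrightarrow> n choose l \<le> n choose i" "\<And>i. i \<in> {0..n} - L \<Longrightarrow> n choose i \<le> n choose l"
    using largest_levels[of k n] k n by auto
  have ln: "l \<le> n" using L(1,4) by auto
  have M: "n \<le> n choose l"
    using kth_largest_level_ge[OF L(1) _ L(4) _ L(6), of 1] L(2) k n by simp
  have "real (card F0) \<le> (\<Sum>i\<in>L. real (n choose i)) - (real (card L) - (real k - 1 / (real n - 1))) * real (n choose l)"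
    using ln L(5,6) lym by (intro card_le_of_weighted_sum[OF F0(1) L(1), where w = "\<lambda>_. 1"]) auto
  also have "\<dots> = real (Sigma_levels n k) - real (n choose l) / (real n - 1)"
    by (simp add: L(2) flip: L(3))
  also have "\<dots> < real (Sigma_levels n k) - 1"
  proof -
    have "1 < real (n choose l) / (real n - 1)" using M k n by (simp add: field_simps)
    then show ?thesis by simp
  qed
  finally have "card F0 + 2 \<le> Sigma_levels n k" by linarith
  moreover have "card F \<le> card F0 + card {{}, {1..n}}"
    unfolding F0_def using finF card_Un_le[of "F - {{}, {1..n}}" "{{}, {1..n}}"]
      card_mono[of "(F - {{}, {1..n}}) \<union> {{}, {1..n}}" F] by fastforce
  moreover have "card {{}, {1..n}} \<le> 2" by (simp add: card_insert_le_m1)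
  ultimately show ?thesis by linarith
qed

section \<open>The theorem\<close>

lemma card_le_of_free:
  assumes k: "2 \<le> k" and n: "k + 1 \<le> n" and F: "F \<subseteq> Pow {1..n}"
    and free: "induced_free (Y_poset k) F" "induced_free (Y_dual k) F"
  shows "card F \<le> Sigma_levels n k"
proof -
  consider "{} \<in> F" | "{1..n} \<in> F" | "{} \<notin> F" "{1..n} \<notin> F" by blast
  then show ?thesis
  proof cases
    case 1
    then show ?thesis using card_le_if_empty_mem k n F free(1) by blast
  next
    case 2
    let ?F = "(-) {1..n} ` F"
    have "inj_on ((-) {1..n}) F"
      using F by (intro inj_on_inverseI[of _ "(-) {1..n}"]) (auto simp: double_diff)
    then have "card F = card ?F" by (simp add: card_image)
    also have "\<dots> \<le> Sigma_levels n k"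
    proof (rule card_le_if_empty_mem[OF k n])
      show "{} \<in> ?F" using 2 by (auto intro!: image_eqI[of _ _ "{1..n}"])
      show "induced_free (Y_poset k) ?F" by (rule induced_free_complement[OF free(2) F])
    qed auto
    finally show ?thesis .
  next
    case 3
    interpret fork_free_family n k F
      using k F 3 chain_above_top[OF _ free(1)] chain_below_bottom[OF _ free(2)]
      by unfold_locales auto
    have "fact n * (\<Sum>A\<in>F. weight A / real (n choose card A)) \<le> real k * fact n"
      using weighted_hits_le sum_hits_total[OF _ F, of weight] by simp
    then have lym: "(\<Sum>A\<in>F. weight A / real (n choose card A)) \<le> real k"
      by (simp add: mult.commute)
    obtain L l where L: "L \<subseteq> {0..n}" "card L = k" "(\<Sum>i\<in>L. n choose i) = Sigma_levels n k"
      "l \<in> L" "\<And>i. i \<in> L \<Longrightarrow> n choose l \<le> n choose i" "\<And>i. i \<in> {0..n} - L \<Longrightarrow> n choose i \<le> n choose l"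
      using largest_levels[of k n] k n by auto
    have ln: "l \<le> n" using L(1,4) by auto
  have M: "n \<le> n choose l"
      using kth_largest_level_ge[OF L(1) _ L(4) _ L(6), of 1] L(2) k n by simp
    have w: "weight A = 1 \<or> real (n choose card A) \<le> real (n choose l) * weight A" for A
    proof (cases "k = 2 \<and> 5 \<le> n \<and> card A = 1")
      case True
      \<comment> \<open>The second largest level has at least 2 n sets, so a singleton of weight one half still pays in full.\<close>
      have "n choose 2 \<le> n choose l"
        using L(2) True by (intro kth_largest_level_ge[OF L(1) _ L(4) _ L(6)]) auto
      moreover have "2 * n \<le> n choose 2"
      proof -
        have "n * 4 \<le> n * (n - 1)" using True by (intro mult_le_mono2) auto
        then show ?thesis unfolding choose_two by linarith
      qed
      ultimately have "2 * n \<le> n choose l" by linarith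
      then have twice: "2 * real n \<le> real (n choose l)" by linarith
      have "weight A = 1 / 2" unfolding weight_def using True by simp
      moreover have "n choose card A = n" using True by simp
      ultimately show ?thesis using twice by (simp only:) simp
    next
      case False
      then show ?thesis unfolding weight_def by auto
    qed
    have "real (card F) \<le> (\<Sum>i\<in>L. real (n choose i)) - (real (card L) - real k) * real (n choose l)"
      using ln L(5,6) lym w by (intro card_le_of_weighted_sum[OF F L(1), where w = weight]) auto
    also have "\<dots> = real (Sigma_levels n k)"
      by (simp add: L(2) flip: L(3))
    finally show ?thesis by simp
  qed
qed

text \<open>A chain in an embedded poset uses different levels, so a union of \<open>k\<close> levels has no room for a
  chain of \<open>k + 1\<close> elements, which both forbidden posets contain.\<close>

lemma card_chain_le_card_levels:
  assumes emb: "induced_subposet P (family_poset F)"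
    and T: "T \<subseteq> fst P" "\<And>x y. x \<in> T \<Longrightarrow> y \<in> T \<Longrightarrow> x \<noteq> y \<Longrightarrow> (x, y) \<in> snd P \<or> (y, x) \<in> snd P"
    and L: "finite L" "\<And>A. A \<in> F \<Longrightarrow> finite A \<and> card A \<in> L"
  shows "card T \<le> card L"
proof -
  obtain \<phi> where \<phi>: "\<phi> ` fst P \<subseteq> F"
      "\<And>x y. x \<in> fst P \<Longrightarrow> y \<in> fst P \<Longrightarrow> (x, y) \<in> snd P \<Longrightarrow> \<phi> x \<subset> \<phi> y"
    using emb unfolding induced_subposet_def family_poset_def by auto
  have less: "card (\<phi> x) < card (\<phi> y)" if "x \<in> fst P" "y \<in> fst P" "(x, y) \<in> snd P" for x y
    using \<phi>(2)[OF that] \<phi>(1) that L(2) by (intro psubset_card_mono) auto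
  have "inj_on (\<lambda>x. card (\<phi> x)) T"
  proof (rule inj_onI, rule ccontr)
    fix x y assume xy: "x \<in> T" "y \<in> T" "card (\<phi> x) = card (\<phi> y)" "x \<noteq> y"
    then have "card (\<phi> x) < card (\<phi> y) \<or> card (\<phi> y) < card (\<phi> x)"
      using less T by blast
    with xy(3) show False by simp
  qed
  moreover have "(\<lambda>x. card (\<phi> x)) ` T \<subseteq> L" using T(1) \<phi>(1) L(2) by blast
  ultimately show ?thesis using L(1) by (rule card_inj_on_le)
qed

lemma levels_free:
  assumes "1 \<le> k" "finite L" "card L = k"
  shows "induced_free (Y_poset k) (\<Union>i\<in>L. level n i)" "induced_free (Y_dual k) (\<Union>i\<in>L. level n i)"
proof -
  let ?F = "\<Union>i\<in>L. level n i"
  \<comment> \<open>The handle together with one prong is a chain of k + 1 elements.\<close>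
  let ?T = "Vx ` {1..k} \<union> {Vy}"
  have F: "finite A \<and> card A \<in> L" if "A \<in> ?F" for A
    using that finite_subset[of A "{1..n}"] by (auto simp: level_def)
  have cT: "card ?T = k + 1"
    by (subst card_Un_disjoint) (auto simp: card_image inj_on_def)
  have T: "?T \<subseteq> fst (Y_poset k)" by (auto simp: Y_poset_def)
  have comp: "(x, y) \<in> snd (Y_poset k) \<or> (y, x) \<in> snd (Y_poset k)"
    if "x \<in> ?T" "y \<in> ?T" "x \<noteq> y" for x y
    using that by (auto simp: Y_poset_def Y_less_iff)
  show "induced_free (Y_poset k) ?F"
    unfolding induced_free_def
    using card_chain_le_card_levels[OF _ T comp assms(2) F] cT assms(3) by fastforce
  show "induced_free (Y_dual k) ?F"
    unfolding induced_free_def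
  proof
    assume emb: "induced_subposet (Y_dual k) (family_poset ?F)"
    have "card ?T \<le> card L"
    proof (rule card_chain_le_card_levels[OF emb _ _ assms(2) F])
      show "?T \<subseteq> fst (Y_dual k)" using T by (simp add: Y_dual_def dual_poset_def)
      show "(x, y) \<in> snd (Y_dual k) \<or> (y, x) \<in> snd (Y_dual k)"
        if "x \<in> ?T" "y \<in> ?T" "x \<noteq> y" for x y
        using comp[OF that] by (auto simp: Y_dual_def dual_poset_def)
    qed
    then show False using cT assms(3) by simp
  qed
qed

theorem theorem2:
  fixes k n :: nat
  assumes "k \<ge> 2" and "n \<ge> k + 1"
  shows "La_star n {Y_poset k, Y_dual k} = Sigma_levels n k"
proof -
  let ?C = "{card \<A> | \<A>. \<A> \<subseteq> Pow {1..n} \<and> (\<forall>P\<in>{Y_poset k, Y_dual k}. induced_free P \<A>)}"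
  have upper: "c \<le> Sigma_levels n k" if "c \<in> ?C" for c
    using that card_le_of_free[OF assms] by auto
  obtain L l where L: "L \<subseteq> {0..n}" "card L = k" "(\<Sum>i\<in>L. n choose i) = Sigma_levels n k"
    using largest_levels[of k n] assms by auto
  have finL: "finite L" using L(1) finite_subset by blast
  let ?F = "\<Union>i\<in>L. level n i"
  have "card ?F = (\<Sum>i\<in>L. card (level n i))"
  proof (rule card_UN_disjoint[OF finL])
    show "\<forall>i\<in>L. finite (level n i)"
      by (auto simp: level_def intro: finite_subset[of _ "Pow {1..n}"])
  qed (auto simp: level_def)
  then have "card ?F = Sigma_levels n k" using L(3) by (simp add: card_level)
  moreover have "?F \<subseteq> Pow {1..n}" by (auto simp: level_def)
  moreover have "\<forall>P\<in>{Y_poset k, Y_dual k}. induced_free P ?F"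
    using levels_free[OF _ finL L(2), of n] assms(1) by auto
  ultimately have "Sigma_levels n k \<in> ?C" by (intro CollectI exI[of _ ?F]) auto
  moreover have "finite ?C"
    using upper by (intro finite_subset[of ?C "{..Sigma_levels n k}"]) auto
  ultimately show ?thesis
    unfolding La_star_def using upper by (intro Max_eqI) auto
qed

end
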